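(* For $n\ge 2$ let $P_n=(2n,\underbrace{2n-2,\dots,2n-2}_{n-2},2n)$, a sequence of $n$ integers with sum $2n^2-2n+4$. (i) For each $n\in\{2,3,4,6\}$ there is a set $S\subseteq\{0,1,\dots,n-1\}^3$ with no three distinct points collinear whose layer profile along each of the three coordinate axes is $P_n$. (ii) For each $n\in\{5,7\}$ there is no set $S\subseteq\{0,1,\dots,n-1\}^3$ with no three distinct points collinear whose layer profile along some coordinate axis is $P_n$.
   Context: For $S\subseteq\{0,\dots,n-1\}^3$ and a coordinate axis $i\in\{1,2,3\}$, the layer profile of $S$ along the axis $i$ is the sequence $(c_0,c_1,\dots,c_{n-1})$ where $c_k$ is the number of points of $S$ whose $i$-th coordinate equals $k$. Collinearity is in the usual sense of $\mathbb{R}^3$. *)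

theory Defs
  imports "HOL-Analysis.Analysis"
begin

definition grid :: "nat \<Rightarrow> (real ^ 3) set" where
  "grid n = {x. \<forall>i. x $ i \<in> real ` {0..<n}}"

definition no_three_collinear :: "(real ^ 3) set \<Rightarrow> bool" where
  "no_three_collinear S \<longleftrightarrow>
     (\<forall>x\<in>S. \<forall>y\<in>S. \<forall>z\<in>S. x \<noteq> y \<and> y \<noteq> z \<and> x \<noteq> z \<longrightarrow> \<not> collinear {x, y, z})"

text \<open>For \<open>S \<subseteq> grid n\<close> the set \<open>S\<close> is finite, so \<open>card\<close> is the true number of points.\<close>

definition layer_profile :: "nat \<Rightarrow> (real ^ 3) set \<Rightarrow> 3 \<Rightarrow> nat list" where
  "layer_profile n S i = map (\<lambda>k. card {x \<in> S. x $ i = real k}) [0..<n]"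

text \<open>Only meaningful for \<open>n \<ge> 2\<close>.\<close>

definition P :: "nat \<Rightarrow> nat list" where
  "P n = [2 * n] @ replicate (n - 2) (2 * n - 2) @ [2 * n]"

end

theory Submission
  imports Defs
begin

text \<open>For \<open>n = 5, 7\<close>: every row and column of a plane layer contains at most two points, so the outer
  layers with \<open>2 n\<close> points have exactly two in each row and column (there are 32 resp. 132 such
  planar sets without three collinear points), and the rows of an inner layer miss at most two points
  altogether, as do its columns. Each bottom/top pair forbids in the inner layers all lattice points on
  the lines joining the two; for most pairs some inner layer is then left with too few admissible
  cells, and for the others a short case distinction on single cells leads to the same contradiction.
  For \<open>n = 5\<close> all inner layers take part, for \<open>n = 7\<close> only those at heights 2, 3 and 4. The
  symmetries of the square and the reflection exchanging top and bottom reduce the number of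
  pairs. The search is a recursive function, proved exhaustive and evaluated by the simplifier.\<close>

section \<open>Collinear lattice points\<close>

text \<open>A search state is a relaxation: each cell is known present, known absent or undecided,
  and the state covers every configuration that agrees with its decided cells. Deductions exclude
  only cells that no covered configuration can use, and branching tries both values of a cell. An
  empty list of final states therefore proves nonexistence, while the branching rule and the bounds
  on depth and on rounds need no correctness proof: a poor choice can only make the check fail. The
  axis along which the profile is given becomes the height. The tolerance of two missing points is
  2n - (2n - 2). For n = 7 the heights 2, 3, 4 are the informative ones. A line from height 0 to
  height 6 meets height 3 in a lattice point when its horizontal displacements are even, and heights
  2 and 4 when they are multiples of 3, whereas heights 1 and 5 require multiples of 6.\<close>

text \<open>A ratio records the position of a coordinate \<open>t\<close> relative to \<open>p\<close> and \<open>q\<close>: \<open>Between m k\<close> is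
  \<open>t = p + (q - p) m / (m + k)\<close>, \<open>Beyond m k\<close> is \<open>t = q + (q - p) m / k\<close>, \<open>Before m k\<close> is
  \<open>t = p + (p - q) m / k\<close>. \<open>Apart\<close> carries no information. Three points are collinear as soon as
  one proper ratio fits all three coordinates.\<close>

datatype ratio = Apart | Same | Between nat nat | Before nat nat | Beyond nat nat

fun fits :: "ratio \<Rightarrow> nat \<Rightarrow> nat \<Rightarrow> nat \<Rightarrow> bool" where
  "fits Apart p q t \<longleftrightarrow> True"
| "fits Same p q t \<longleftrightarrow> p = q \<and> q = t"
| "fits (Between m k) p q t \<longleftrightarrow> t * (m + k) = p * k + q * m"
| "fits (Beyond m k) p q t \<longleftrightarrow> t * k + p * m = q * (m + k)"
| "fits (Before m k) p q t \<longleftrightarrow> t * k + q * m = p * (m + k)"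

fun proper :: "ratio \<Rightarrow> bool" where
  "proper (Between m k) \<longleftrightarrow> 0 < m \<and> 0 < k"
| "proper (Beyond m k) \<longleftrightarrow> 0 < m \<and> 0 < k"
| "proper (Before m k) \<longleftrightarrow> 0 < m \<and> 0 < k"
| "proper Apart \<longleftrightarrow> False"
| "proper Same \<longleftrightarrow> False"

lemma fits_refl: "fits r a a a"
  by (cases r) (auto simp: algebra_simps)

lemma fits_Suc: "fits r (Suc p) (Suc q) (Suc t) \<longleftrightarrow> fits r p q t"
  by (cases r) (auto simp: algebra_simps)

text \<open>Both sides of each equation carry the same total weight, so replacing every coordinate
  by its distance from \<open>n\<close> preserves it. The bounds keep truncated subtraction
  exact.\<close>

lemma fits_reflect:
  assumes "p \<le> n" "q \<le> n" "t \<le> n" "fits r (n - p) (n - q) (n - t)"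
  shows "fits r p q t"
proof -
  define p' q' t' where d: "p' = n - p" "q' = n - q" "t' = n - t"
  have n: "p + p' = n" "q + q' = n" "t + t' = n"
    using assms(1-3) by (simp_all add: d)
  have *: "p * a + p' * a = n * a" "q * a + q' * a = n * a" "t * a + t' * a = n * a" for a
    by (simp_all only: n add_mult_distrib [symmetric])
  have f: "fits r p' q' t'" using assms(4) by (simp only: d)
  show ?thesis
  proof (cases r)
    case (Between m k)
    show ?thesis
      using f *(1)[of k] *(2)[of m] *(3)[of k] *(3)[of m]
      by (simp only: Between fits.simps add_mult_distrib2)
  next
    case (Before m k)
    show ?thesis
      using f *(1)[of k] *(2)[of m] *(3)[of k] *(1)[of m]
      by (simp only: Before fits.simps add_mult_distrib2)
  next
    case (Beyond m k)
    show ?thesis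
      using f *(2)[of k] *(2)[of m] *(3)[of k] *(1)[of m]
      by (simp only: Beyond fits.simps add_mult_distrib2)
  qed (use f n in auto)
qed

text \<open>The argument is the difference minus one, so that every weight built by
  \<open>locate\<close> has the form \<open>Suc\<close> and is positive, without any
  subtraction.\<close>

datatype comparison = Less nat | Equal | Greater nat

fun cmp :: "nat \<Rightarrow> nat \<Rightarrow> comparison" where
  "cmp 0 0 = Equal"
| "cmp 0 (Suc b) = Less b"
| "cmp (Suc a) 0 = Greater a"
| "cmp (Suc a) (Suc b) = cmp a b"

lemma cmp_Less: "cmp a b = Less d \<Longrightarrow> b = Suc (a + d)"
  by (induction a b rule: cmp.induct) auto

lemma cmp_Equal: "cmp a b = Equal \<Longrightarrow> a = b"
  by (induction a b rule: cmp.induct) auto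

lemma cmp_Greater: "cmp a b = Greater d \<Longrightarrow> a = Suc (b + d)"
  by (induction a b rule: cmp.induct) auto

fun locate_below :: "nat \<Rightarrow> nat \<Rightarrow> comparison \<Rightarrow> ratio" where
  "locate_below p q (Less d) = Before (Suc p) (Suc d)"
| "locate_below p q Equal = Apart"
| "locate_below p q (Greater d) = Beyond (Suc q) (Suc d)"

fun locate_from_p :: "nat \<Rightarrow> nat \<Rightarrow> comparison \<Rightarrow> ratio" where
  "locate_from_p q t (Less d) = Between (Suc t) (Suc d)"
| "locate_from_p q t Equal = Apart"
| "locate_from_p q t (Greater d) = Beyond (Suc d) (Suc q)"

fun locate_from_q :: "nat \<Rightarrow> nat \<Rightarrow> comparison \<Rightarrow> ratio" where
  "locate_from_q p t (Less d) = Between (Suc d) (Suc t)"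
| "locate_from_q p t Equal = Apart"
| "locate_from_q p t (Greater d) = Before (Suc d) (Suc p)"

text \<open>Stripping common successors moves the least coordinate to 0, where the other two are the
  distances that form the ratio. \<open>Same\<close> leaves the ratio open, since three equal
  coordinates fit every ratio; \<open>Apart\<close> arises when exactly two coordinates agree, which
  no proper ratio allows.\<close>

fun locate :: "nat \<Rightarrow> nat \<Rightarrow> nat \<Rightarrow> ratio" where
  "locate (Suc p) (Suc q) (Suc t) = locate p q t"
| "locate 0 0 0 = Same"
| "locate 0 0 (Suc t) = Apart"
| "locate 0 (Suc q) 0 = Apart"
| "locate (Suc p) 0 0 = Apart"
| "locate (Suc p) (Suc q) 0 = locate_below p q (cmp p q)"
| "locate 0 (Suc q) (Suc t) = locate_from_p q t (cmp t q)"
| "locate (Suc p) 0 (Suc t) = locate_from_q p t (cmp t p)"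

lemma fits_locate: "fits (locate p q t) p q t"
proof (induction p q t rule: locate.induct)
  case (6 p q)
  then show ?case
    by (cases "cmp p q") (auto dest!: cmp_Less cmp_Greater simp: algebra_simps)
next
  case (7 q t)
  then show ?case
    by (cases "cmp t q") (auto dest!: cmp_Less cmp_Greater simp: algebra_simps)
next
  case (8 p t)
  then show ?case
    by (cases "cmp t p") (auto dest!: cmp_Less cmp_Greater simp: algebra_simps)
qed (simp_all add: fits_Suc del: fits.simps, simp_all)

lemma locate_cases: "proper (locate p q t) \<or> locate p q t = Apart \<or> locate p q t = Same"
proof (induction p q t rule: locate.induct)
  case (6 p q)
  then show ?case by (cases "cmp p q") auto
next
  case (7 q t)
  then show ?case by (cases "cmp t q") auto
next
  case (8 p t)
  then show ?case by (cases "cmp t p") auto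
qed auto

text \<open>\<open>exact_div k a n\<close> is \<open>a + n / k\<close> if \<open>k\<close> divides \<open>n\<close>; in \<open>exact_div_block k a j n\<close> the current
  block of \<open>k + 1\<close> units still lacks \<open>j\<close> of them.\<close>

fun exact_div :: "nat \<Rightarrow> nat \<Rightarrow> nat \<Rightarrow> nat option"
  and exact_div_block :: "nat \<Rightarrow> nat \<Rightarrow> nat \<Rightarrow> nat \<Rightarrow> nat option" where
  "exact_div k a 0 = Some a"
| "exact_div 0 a (Suc n) = None"
| "exact_div (Suc k) a (Suc n) = exact_div_block k a k n"
| "exact_div_block k a 0 n = exact_div (Suc k) (Suc a) n"
| "exact_div_block k a (Suc j) 0 = None"
| "exact_div_block k a (Suc j) (Suc n) = exact_div_block k a j n"

text \<open>Entering a block promises one more unit of the quotient, of which \<open>j\<close> units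
  of the dividend are still to be paid. This accounts for the correction terms \<open>j\<close> and
  \<open>Suc k'\<close> in the second equation.\<close>

lemma exact_div_Some:
  "exact_div k a n = Some c \<Longrightarrow> c * k = a * k + n"
  "exact_div_block k' a j n = Some c \<Longrightarrow> c * Suc k' + j = a * Suc k' + n + Suc k'"
  by (induction k a n and k' a j n rule: exact_div_exact_div_block.induct) auto

fun minus_opt :: "nat \<Rightarrow> nat \<Rightarrow> nat option" where
  "minus_opt a 0 = Some a"
| "minus_opt 0 (Suc b) = None"
| "minus_opt (Suc a) (Suc b) = minus_opt a b"

lemma minus_opt_eq: "minus_opt a b = (if b \<le> a then Some (a - b) else None)"
  by (induction a b rule: minus_opt.induct) auto

fun minus_quotient :: "nat \<Rightarrow> nat option \<Rightarrow> nat option" where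
  "minus_quotient a None = None"
| "minus_quotient a (Some b) = minus_opt a b"

text \<open>The common part of the two coordinates is moved into the offset \<open>a\<close> before
  anything is multiplied, which keeps the unary products small.\<close>

fun third_between :: "nat \<Rightarrow> nat \<Rightarrow> nat \<Rightarrow> nat \<Rightarrow> nat \<Rightarrow> nat option" where
  "third_between m k a (Suc p) (Suc q) = third_between m k (Suc a) p q"
| "third_between m k a 0 q = exact_div (m + k) a (q * m)"
| "third_between m k a (Suc p) 0 = exact_div (m + k) a (Suc p * k)"

fun third_beyond :: "nat \<Rightarrow> nat \<Rightarrow> nat \<Rightarrow> nat \<Rightarrow> nat \<Rightarrow> nat option" where
  "third_beyond m k a (Suc p) (Suc q) = third_beyond m k (Suc a) p q"
| "third_beyond m k a 0 q = exact_div k (q + a) (q * m)"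
| "third_beyond m k a (Suc p) 0 = minus_quotient a (exact_div k 0 (Suc p * m))"

fun third :: "ratio \<Rightarrow> nat \<Rightarrow> nat \<Rightarrow> nat option" where
  "third Apart p q = None"
| "third Same p q = None"
| "third (Between m k) p q = third_between m k 0 p q"
| "third (Beyond m k) p q = third_beyond m k 0 p q"
| "third (Before m k) p q = third_beyond m k 0 q p"

lemma third_between_Some:
  "third_between m k a p q = Some t \<Longrightarrow> t * (m + k) = a * (m + k) + p * k + q * m"
  by (induction m k a p q rule: third_between.induct)
    (auto dest!: exact_div_Some(1) simp: algebra_simps)

lemma third_beyond_Some:
  "third_beyond m k a p q = Some t \<Longrightarrow> t * k + p * m = a * k + q * (m + k)"
proof (induction m k a p q rule: third_beyond.induct)
  case (3 m k a p)
  then obtain b where b: "exact_div k 0 (Suc p * m) = Some b" "minus_opt a b = Some t"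
    by (cases "exact_div k 0 (Suc p * m)") auto
  have "b * k = Suc p * m"
    using exact_div_Some(1)[OF b(1)] by simp
  moreover have "a = t + b"
    using b(2) by (simp add: minus_opt_eq split: if_splits)
  ultimately show ?case by (simp only: add_mult_distrib mult_0 add_0_right)
qed (auto dest!: exact_div_Some(1) simp: algebra_simps)

lemma fits_third: "third r p q = Some t \<Longrightarrow> fits r p q t"
  by (cases r) (auto dest!: third_between_Some third_beyond_Some simp: algebra_simps)

section \<open>The search\<close>

text \<open>The simplifier normalises the arguments of a function before it applies a defining equation, and
  would unroll a recursion below \<open>if\<close> or \<open>case\<close>. Therefore every test hands its result to an
  auxiliary function that is defined by pattern matching, and numbers are unary.\<close>

datatype cell = In | Open | Out
datatype point = Point nat nat nat
text \<open>In \<open>Layer z c rs\<close> the number \<open>c\<close> is how many points the layer at height \<open>z\<close> has fewer than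
  twice the number of its rows.\<close>

datatype layer = Layer nat nat "cell list list"

fun put :: "cell \<Rightarrow> nat \<Rightarrow> nat \<Rightarrow> cell list list \<Rightarrow> cell list list" where
  "put v x y [] = []"
| "put v 0 y (r # rs) = r[y := v] # rs"
| "put v (Suc x) y (r # rs) = r # put v x y rs"

fun put_opt :: "nat \<Rightarrow> nat option \<Rightarrow> cell list list \<Rightarrow> cell list list" where
  "put_opt x None rs = rs"
| "put_opt x (Some y) rs = put Out x y rs"

fun kill_cell :: "ratio \<Rightarrow> cell \<Rightarrow> cell" where
  "kill_cell Apart c = c"
| "kill_cell Same c = c"
| "kill_cell (Between m k) c = Out"
| "kill_cell (Before m k) c = Out"
| "kill_cell (Beyond m k) c = Out"

fun kill_cells :: "nat \<Rightarrow> nat \<Rightarrow> nat \<Rightarrow> cell list \<Rightarrow> cell list" where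
  "kill_cells p q t [] = []"
| "kill_cells p q t (c # cs) = kill_cell (locate p q t) c # kill_cells p q (Suc t) cs"

fun clear_opt :: "nat option \<Rightarrow> cell list \<Rightarrow> cell list" where
  "clear_opt None r = r"
| "clear_opt (Some y) r = r[y := Out]"

fun kill_row :: "nat \<Rightarrow> nat \<Rightarrow> ratio \<Rightarrow> cell list \<Rightarrow> cell list" where
  "kill_row p q Apart r = r"
| "kill_row p q Same r = kill_cells p q 0 r"
| "kill_row p q (Between m k) r = clear_opt (third (Between m k) p q) r"
| "kill_row p q (Before m k) r = clear_opt (third (Before m k) p q) r"
| "kill_row p q (Beyond m k) r = clear_opt (third (Beyond m k) p q) r"

fun kill_rows :: "nat \<Rightarrow> nat \<Rightarrow> nat \<Rightarrow> nat \<Rightarrow> nat \<Rightarrow> cell list list \<Rightarrow> cell list list" where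
  "kill_rows p q p' q' t [] = []"
| "kill_rows p q p' q' t (r # rs) =
     kill_row p' q' (locate p q t) r # kill_rows p q p' q' (Suc t) rs"

fun kill_at :: "nat option \<Rightarrow> ratio \<Rightarrow> nat \<Rightarrow> nat \<Rightarrow> cell list list \<Rightarrow> cell list list" where
  "kill_at None \<rho> p q rs = rs"
| "kill_at (Some x) \<rho> p q rs = put_opt x (third \<rho> p q) rs"

fun kill_layer :: "nat \<Rightarrow> nat \<Rightarrow> nat \<Rightarrow> nat \<Rightarrow> ratio \<Rightarrow> cell list list \<Rightarrow> cell list list" where
  "kill_layer p q p' q' Apart rs = rs"
| "kill_layer p q p' q' Same rs = kill_rows p q p' q' 0 rs"
| "kill_layer p q p' q' (Between m k) rs = kill_at (third (Between m k) p q) (Between m k) p' q' rs"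
| "kill_layer p q p' q' (Before m k) rs = kill_at (third (Before m k) p q) (Before m k) p' q' rs"
| "kill_layer p q p' q' (Beyond m k) rs = kill_at (third (Beyond m k) p q) (Beyond m k) p' q' rs"

fun kill :: "point \<Rightarrow> point \<Rightarrow> layer list \<Rightarrow> layer list" where
  "kill p q [] = []"
| "kill (Point z x y) (Point z' x' y') (Layer t c rs # G) =
     Layer t c (kill_layer x x' y y' (locate z z' t) rs) # kill (Point z x y) (Point z' x' y') G"

fun kill_all :: "point \<Rightarrow> point list \<Rightarrow> layer list \<Rightarrow> layer list" where
  "kill_all p [] G = G"
| "kill_all p (q # C) G = kill_all p C (kill p q G)"

fun mark_rows :: "cell \<Rightarrow> nat \<Rightarrow> nat \<Rightarrow> comparison \<Rightarrow> cell list list \<Rightarrow> cell list list" where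
  "mark_rows v x y Equal rs = put v x y rs"
| "mark_rows v x y (Less d) rs = rs"
| "mark_rows v x y (Greater d) rs = rs"

fun mark :: "cell \<Rightarrow> point \<Rightarrow> layer list \<Rightarrow> layer list" where
  "mark v p [] = []"
| "mark v (Point z x y) (Layer t c rs # G) =
     Layer t c (mark_rows v x y (cmp z t) rs) # mark v (Point z x y) G"

section \<open>Counting admissible cells and choosing the cell to branch on\<close>

fun row_info :: "nat \<Rightarrow> bool \<Rightarrow> cell list \<Rightarrow> nat \<times> bool" where
  "row_info a u [] = (a, u)"
| "row_info a u (In # r) = row_info (Suc a) u r"
| "row_info a u (Open # r) = row_info (Suc a) True r"
| "row_info a u (Out # r) = row_info a u r"

fun row_infos :: "cell list list \<Rightarrow> (nat \<times> bool) list" where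
  "row_infos [] = []"
| "row_infos (r # rs) = row_info 0 False r # row_infos rs"

fun deficit :: "(nat \<times> bool) list \<Rightarrow> nat" where
  "deficit [] = 0"
| "deficit ((0, u) # l) = Suc (Suc (deficit l))"
| "deficit ((Suc 0, u) # l) = Suc (deficit l)"
| "deficit ((Suc (Suc a), u) # l) = deficit l"

fun zip_cons :: "'a list \<Rightarrow> 'a list list \<Rightarrow> 'a list list" where
  "zip_cons [] ls = ls"
| "zip_cons (c # cs) [] = [c] # zip_cons cs []"
| "zip_cons (c # cs) (l # ls) = (c # l) # zip_cons cs ls"

fun transpose_rows :: "'a list list \<Rightarrow> 'a list list" where
  "transpose_rows [] = []"
| "transpose_rows (r # rs) = zip_cons r (transpose_rows rs)"

datatype choice = NoChoice | Choice nat bool nat nat "cell list"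

fun select :: "comparison \<Rightarrow> 'a \<Rightarrow> 'a \<Rightarrow> 'a" where
  "select (Less d) a b = a"
| "select Equal a b = b"
| "select (Greater d) a b = b"

text \<open>A fail-first rule: the score is twice the number of points that the layer can still
  afford to miss in this direction, plus the number of cells of the line not yet excluded. The
  lowest score wins and ties keep the earlier candidate.\<close>

fun better :: "choice \<Rightarrow> nat \<Rightarrow> bool \<Rightarrow> nat \<Rightarrow> nat \<Rightarrow> cell list \<Rightarrow> choice" where
  "better NoChoice s d z i r = Choice s d z i r"
| "better (Choice s' d' z' i' r') s d z i r =
     select (cmp s s') (Choice s d z i r) (Choice s' d' z' i' r')"

fun choose_line :: "choice \<Rightarrow> bool \<Rightarrow> nat \<Rightarrow> nat \<Rightarrow> nat \<Rightarrow> (nat \<times> bool) list \<Rightarrow> cell list list \<Rightarrow> choice" where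
  "choose_line b d z s i [] rs = b"
| "choose_line b d z s i ((a, False) # l) (r # rs) = choose_line b d z s (Suc i) l rs"
| "choose_line b d z s i ((a, True) # l) (r # rs) = choose_line (better b (s + a) d z i r) d z s (Suc i) l rs"
| "choose_line b d z s i (v # l) [] = b"

text \<open>The choice of the line to branch on does not affect soundness. Scanning from the third line on
  halves the number of nodes for \<open>n = 7\<close>.\<close>

fun choose_lines ::
  "choice \<Rightarrow> bool \<Rightarrow> nat \<Rightarrow> nat \<Rightarrow> (nat \<times> bool) list \<Rightarrow> cell list list \<Rightarrow> choice" where
  "choose_lines b d z s (v # w # l) (q # r # rs) =
     choose_line (choose_line b d z s (Suc (Suc 0)) l rs) d z s 0 [v, w] [q, r]"
| "choose_lines b d z s [] rs = b"
| "choose_lines b d z s [v] rs = b"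
| "choose_lines b d z s (v # w # l) [] = b"
| "choose_lines b d z s (v # w # l) [r] = b"

fun inspect_columns ::
  "nat option \<Rightarrow> choice \<Rightarrow> nat \<Rightarrow> (nat \<times> bool) list \<Rightarrow> cell list list \<Rightarrow> choice option" where
  "inspect_columns None b z l ts = None"
| "inspect_columns (Some s) b z l ts = Some (choose_lines b True z (s + s) l ts)"

fun inspect_rows ::
  "nat option \<Rightarrow> choice \<Rightarrow> nat \<Rightarrow> nat \<Rightarrow> cell list list \<Rightarrow> (nat \<times> bool) list \<Rightarrow> cell list list \<Rightarrow>
     (nat \<times> bool) list \<Rightarrow> choice option" where
  "inspect_rows None b z c rs l ts l' = None"
| "inspect_rows (Some s) b z c rs l ts l' =
     inspect_columns (minus_opt c (deficit l')) (choose_lines b False z (s + s) l rs) z l' ts"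

fun inspect_layer ::
  "choice \<Rightarrow> nat \<Rightarrow> nat \<Rightarrow> cell list list \<Rightarrow> cell list list \<Rightarrow> (nat \<times> bool) list \<Rightarrow> choice option" where
  "inspect_layer b z c rs ts l = inspect_rows (minus_opt c (deficit l)) b z c rs l ts (row_infos ts)"

fun inspect :: "choice option \<Rightarrow> layer list \<Rightarrow> choice option" where
  "inspect None G = None"
| "inspect (Some b) [] = Some b"
| "inspect (Some b) (Layer z c rs # G) = inspect (inspect_layer b z c rs (transpose_rows rs) (row_infos rs)) G"

fun first_open :: "nat \<Rightarrow> cell list \<Rightarrow> nat" where
  "first_open i [] = i"
| "first_open i (Open # r) = i"
| "first_open i (In # r) = first_open (Suc i) r"
| "first_open i (Out # r) = first_open (Suc i) r"

fun line_point :: "bool \<Rightarrow> nat \<Rightarrow> nat \<Rightarrow> nat \<Rightarrow> point" where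
  "line_point False z i j = Point z i j"
| "line_point True z i j = Point z j i"

datatype verdict = Dead | Done | Split point

fun verdict_of :: "choice option \<Rightarrow> verdict" where
  "verdict_of None = Dead"
| "verdict_of (Some NoChoice) = Done"
| "verdict_of (Some (Choice s d z i r)) = Split (line_point d z i (first_open 0 r))"

text \<open>When the fuel \<open>f\<close> is exhausted the unfinished state itself is returned, so that no solution gets
  lost.\<close>

fun solve :: "nat \<Rightarrow> point list \<Rightarrow> layer list \<Rightarrow> layer list list"
  and branch :: "nat \<Rightarrow> point list \<Rightarrow> layer list \<Rightarrow> verdict \<Rightarrow> layer list list" where
  "solve 0 C G = [G]"
| "solve (Suc f) C G = branch f C G (verdict_of (inspect (Some NoChoice) G))"
| "branch f C G Dead = []"
| "branch f C G Done = [G]"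
| "branch f C G (Split p) =
     solve f (p # C) (kill_all p C (mark In p G)) @ solve f C (mark Out p G)"

section \<open>Lines joining the bottom and the top layer\<close>

fun points_of_row :: "nat \<Rightarrow> nat \<Rightarrow> nat \<Rightarrow> cell list \<Rightarrow> point list \<Rightarrow> point list" where
  "points_of_row z x y [] ps = ps"
| "points_of_row z x y (In # r) ps = Point z x y # points_of_row z x (Suc y) r ps"
| "points_of_row z x y (Open # r) ps = points_of_row z x (Suc y) r ps"
| "points_of_row z x y (Out # r) ps = points_of_row z x (Suc y) r ps"

fun points_of :: "nat \<Rightarrow> nat \<Rightarrow> cell list list \<Rightarrow> point list" where
  "points_of z x [] = []"
| "points_of z x (r # rs) = points_of_row z x 0 r (points_of z (Suc x) rs)"

fun row_positions :: "nat \<Rightarrow> cell list \<Rightarrow> nat list" where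
  "row_positions y [] = []"
| "row_positions y (In # r) = y # row_positions (Suc y) r"
| "row_positions y (Open # r) = row_positions (Suc y) r"
| "row_positions y (Out # r) = row_positions (Suc y) r"

fun positions :: "cell list list \<Rightarrow> nat list list" where
  "positions [] = []"
| "positions (r # rs) = row_positions 0 r # positions rs"

fun cross_point :: "ratio \<Rightarrow> nat \<Rightarrow> nat \<Rightarrow> nat list \<Rightarrow> cell list list \<Rightarrow> cell list list" where
  "cross_point \<rho> x y [] rs = rs"
| "cross_point \<rho> x y (y' # ys') rs = cross_point \<rho> x y ys' (put_opt x (third \<rho> y y') rs)"

fun cross_row :: "nat option \<Rightarrow> ratio \<Rightarrow> nat list \<Rightarrow> nat list \<Rightarrow> cell list list \<Rightarrow> cell list list" where
  "cross_row None \<rho> ys ys' rs = rs"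
| "cross_row (Some x) \<rho> [] ys' rs = rs"
| "cross_row (Some x) \<rho> (y # ys) ys' rs = cross_row (Some x) \<rho> ys ys' (cross_point \<rho> x y ys' rs)"

fun cross_rows ::
  "ratio \<Rightarrow> nat \<Rightarrow> nat list \<Rightarrow> nat \<Rightarrow> nat list list \<Rightarrow> cell list list \<Rightarrow> cell list list" where
  "cross_rows \<rho> x ys x' [] rs = rs"
| "cross_rows \<rho> x ys x' (ys' # B) rs =
     cross_rows \<rho> x ys (Suc x') B (cross_row (third \<rho> x x') \<rho> ys ys' rs)"

fun cross_layer ::
  "ratio \<Rightarrow> nat \<Rightarrow> nat list list \<Rightarrow> nat list list \<Rightarrow> cell list list \<Rightarrow> cell list list" where
  "cross_layer \<rho> x [] B rs = rs"
| "cross_layer \<rho> x (ys # A) B rs = cross_layer \<rho> (Suc x) A B (cross_rows \<rho> x ys 0 B rs)"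

text \<open>All lines from height 0 to height \<open>m\<close> cut a given layer in the same ratio,
  so the ratio is computed once per layer and not once per pair of points as in
  \<open>kill\<close>.\<close>

fun cross :: "nat \<Rightarrow> nat list list \<Rightarrow> nat list list \<Rightarrow> layer list \<Rightarrow> layer list" where
  "cross m A B [] = []"
| "cross m A B (Layer t c rs # G) = Layer t c (cross_layer (locate 0 m t) 0 A B rs) # cross m A B G"

fun is_Nil :: "'a list \<Rightarrow> bool" where
  "is_Nil [] = True"
| "is_Nil (x # xs) = False"

fun pairs_excluded ::
  "nat \<Rightarrow> nat \<Rightarrow> point list \<Rightarrow> nat list list \<Rightarrow> layer list \<Rightarrow> cell list list list \<Rightarrow> bool" where
  "pairs_excluded f m C A G [] = True"
| "pairs_excluded f m C A G (B # Bs) =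
     (is_Nil (solve f (C @ points_of m 0 B) (cross m A (positions B) G)) \<and>
      pairs_excluded f m C A G Bs)"

text \<open>An undecided cell compares as different even from itself. This errs on the safe side: a
  failed comparison only keeps one more layer in the list to be tested.\<close>

fun eq_row :: "cell list \<Rightarrow> cell list \<Rightarrow> bool" where
  "eq_row [] [] = True"
| "eq_row (In # a) (In # b) = eq_row a b"
| "eq_row (Out # a) (Out # b) = eq_row a b"
| "eq_row (In # a) (Out # b) = False"
| "eq_row (Out # a) (In # b) = False"
| "eq_row (Open # a) b = False"
| "eq_row (In # a) (Open # b) = False"
| "eq_row (Out # a) (Open # b) = False"
| "eq_row (In # a) [] = False"
| "eq_row (Out # a) [] = False"
| "eq_row [] (c # b) = False"

fun eq_rows :: "cell list list \<Rightarrow> cell list list \<Rightarrow> bool"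
  and eq_rows_rest :: "bool \<Rightarrow> cell list list \<Rightarrow> cell list list \<Rightarrow> bool" where
  "eq_rows [] [] = True"
| "eq_rows [] (b # bs) = False"
| "eq_rows (a # as) [] = False"
| "eq_rows (a # as) (b # bs) = eq_rows_rest (eq_row a b) as bs"
| "eq_rows_rest True as bs = eq_rows as bs"
| "eq_rows_rest False as bs = False"

fun mem_rows :: "cell list list \<Rightarrow> cell list list list \<Rightarrow> bool"
  and mem_rows_rest :: "bool \<Rightarrow> cell list list \<Rightarrow> cell list list list \<Rightarrow> bool" where
  "mem_rows a [] = False"
| "mem_rows a (b # bs) = mem_rows_rest (eq_rows a b) a bs"
| "mem_rows_rest True a bs = True"
| "mem_rows_rest False a bs = mem_rows a bs"

section \<open>The eight symmetries of the square\<close>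

fun flips :: "'a list list \<Rightarrow> 'a list list list" where
  "flips A = [A, rev A, map rev A, map rev (rev A)]"

fun orbit :: "'a list list \<Rightarrow> 'a list list list" where
  "orbit A = flips A @ map transpose_rows (flips A)"

fun remove_orbit :: "cell list list \<Rightarrow> cell list list list \<Rightarrow> cell list list list"
  and remove_head :: "bool \<Rightarrow> cell list list \<Rightarrow> cell list list \<Rightarrow> cell list list list \<Rightarrow> cell list list list" where
  "remove_orbit a [] = []"
| "remove_orbit a (b # bs) = remove_head (mem_rows a (orbit b)) a b bs"
| "remove_head True a b bs = remove_orbit a bs"
| "remove_head False a b bs = b # remove_orbit a bs"

text \<open>Once \<open>A\<close> is excluded as bottom layer, symmetry excludes its whole orbit for the bottom and for the
  top layer.\<close>

fun full_layers_excluded :: "nat \<Rightarrow> nat \<Rightarrow> nat \<Rightarrow> layer list \<Rightarrow> cell list list list \<Rightarrow> bool" where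
  "full_layers_excluded 0 f m G L = is_Nil L"
| "full_layers_excluded (Suc n) f m G [] = True"
| "full_layers_excluded (Suc n) f m G (A # L) =
     (pairs_excluded f m (points_of 0 0 A) (positions A) G (A # L) \<and>
      full_layers_excluded n f m G (remove_orbit A L))"

fun copies :: "nat \<Rightarrow> 'a \<Rightarrow> 'a list" where
  "copies 0 c = []"
| "copies (Suc n) c = c # copies n c"

fun open_layer :: "nat \<Rightarrow> nat \<Rightarrow> nat \<Rightarrow> layer" where
  "open_layer n c z = Layer z c (copies n (copies n Open))"

fun rows_of :: "layer list list \<Rightarrow> cell list list list" where
  "rows_of [] = []"
| "rows_of ([] # l) = rows_of l"
| "rows_of ((Layer z c rs # G) # l) = rs # rows_of l"

text \<open>The first 0 is the number of missing points, which forces two points into every row and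
  column; the second is the height. The same list serves for the top layer by reflection of the
  heights.\<close>

definition full_layers :: "nat \<Rightarrow> cell list list list" where
  "full_layers n = rows_of (solve (n * n) [] [open_layer n 0 0])"

text \<open>\<open>Suc (Suc 0)\<close> is the shortfall of an inner layer. The first cube bounds the
  number of rounds, the second the depth of the search; a bound that is too small makes the check
  fail instead of succeed.\<close>

definition impossible :: "nat \<Rightarrow> nat list \<Rightarrow> bool" where
  "impossible m zs = full_layers_excluded (Suc m * Suc m * Suc m) (Suc m * Suc m * Suc m) m
     (map (open_layer (Suc m) (Suc (Suc 0))) zs) (full_layers (Suc m))"

section \<open>Exhaustiveness of the search\<close>

text \<open>Distinctness is demanded of the first two points alone: for a proper ratio the third
  point then differs from both.\<close>

definition line_free :: "(nat \<Rightarrow> nat \<Rightarrow> nat \<Rightarrow> bool) \<Rightarrow> bool" where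
  "line_free s \<longleftrightarrow> (\<forall>\<rho> x y z x' y' z' u v w. proper \<rho> \<longrightarrow> s z x y \<longrightarrow> s z' x' y' \<longrightarrow> s w u v \<longrightarrow>
     fits \<rho> z z' w \<longrightarrow> fits \<rho> x x' u \<longrightarrow> fits \<rho> y y' v \<longrightarrow> z = z' \<and> x = x' \<and> y = y')"

definition layer_total :: "nat \<Rightarrow> (nat \<Rightarrow> nat \<Rightarrow> bool) \<Rightarrow> nat" where
  "layer_total m g = (\<Sum>x = 0..m. \<Sum>y = 0..m. of_bool (g x y))"

text \<open>Here \<open>m = n - 1\<close>, and \<open>s z x y\<close> says that the point with height \<open>z\<close> is present.\<close>

definition config :: "nat \<Rightarrow> (nat \<Rightarrow> nat \<Rightarrow> nat \<Rightarrow> bool) \<Rightarrow> bool" where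
  "config m s \<longleftrightarrow> (\<forall>z x y. s z x y \<longrightarrow> z \<le> m \<and> x \<le> m \<and> y \<le> m) \<and> line_free s \<and>
     (\<forall>z\<le>m. layer_total m (s z) = (if z = 0 \<or> z = m then 2 * Suc m else 2 * m))"

fun admits :: "cell \<Rightarrow> bool \<Rightarrow> bool" where
  "admits In b \<longleftrightarrow> b"
| "admits Open b \<longleftrightarrow> True"
| "admits Out b \<longleftrightarrow> \<not> b"

definition conforms :: "nat \<Rightarrow> (nat \<Rightarrow> nat \<Rightarrow> bool) \<Rightarrow> cell list list \<Rightarrow> bool" where
  "conforms m g rs \<longleftrightarrow> length rs = Suc m \<and>
     (\<forall>x\<le>m. length (rs ! x) = Suc m \<and> (\<forall>y\<le>m. admits (rs ! x ! y) (g x y)))"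

fun layer_ok :: "nat \<Rightarrow> (nat \<Rightarrow> nat \<Rightarrow> nat \<Rightarrow> bool) \<Rightarrow> layer \<Rightarrow> bool" where
  "layer_ok m s (Layer z c rs) \<longleftrightarrow> conforms m (s z) rs \<and> layer_total m (s z) + c = 2 * Suc m"

fun holds :: "(nat \<Rightarrow> nat \<Rightarrow> nat \<Rightarrow> bool) \<Rightarrow> point \<Rightarrow> bool" where
  "holds s (Point z x y) \<longleftrightarrow> s z x y"

fun height :: "layer \<Rightarrow> nat" where
  "height (Layer z c rs) = z"

section \<open>Excluding the points of a line loses no configuration\<close>

lemma line_freeD:
  assumes "line_free s" "proper \<rho>" "s z x y" "s z' x' y'"
    and "fits \<rho> z z' w" "fits \<rho> x x' u" "fits \<rho> y y' v"
    and "\<not> (z = z' \<and> x = x' \<and> y = y')"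
  shows "\<not> s w u v"
  using assms unfolding line_free_def by blast

lemma length_put [simp]: "length (put v x y rs) = length rs"
  by (induction v x y rs rule: put.induct) auto

lemma nth_put: "i < length rs \<Longrightarrow> put v x y rs ! i = (if i = x then (rs ! i)[y := v] else rs ! i)"
  by (induction v x y rs arbitrary: i rule: put.induct) (auto simp: nth_Cons split: nat.splits)

lemma nth_list_update_if: "j < length r \<Longrightarrow> r[i := v] ! j = (if i = j then v else r ! j)"
  by (cases "i = j") auto

text \<open>Updates at positions outside the grid change nothing, so a third point that falls
  outside needs no separate test.\<close>

lemma conforms_put:
  assumes "conforms m g rs" "admits v (g x y)"
  shows "conforms m g (put v x y rs)"
  using assms by (auto simp: conforms_def nth_put nth_list_update_if)

lemma proper_locate_distinct: "proper (locate p q t) \<Longrightarrow> p \<noteq> q"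
proof -
  have "\<not> proper (locate a a t)" for a
  proof (induction a arbitrary: t)
    case (Suc a)
    have "cmp a a = Equal" by (induction a) auto
    with Suc show ?case by (cases t) auto
  qed (case_tac t; auto)
  then show "proper (locate p q t) \<Longrightarrow> p \<noteq> q" by auto
qed

lemma third_locate_proper:
  assumes "third (locate p q t) p' q' = Some u"
  shows "proper (locate p q t)"
  using assms locate_cases[of p q t] by auto

lemma locate_Same: "locate p q t = Same \<Longrightarrow> p = t \<and> q = t"
  using fits_locate[of p q t] by simp

lemma kill_proper:
  assumes "proper \<rho>"
  shows "kill_cell \<rho> c = Out" "kill_row p q \<rho> r = clear_opt (third \<rho> p q) r"
    "kill_layer p q p' q' \<rho> rs = kill_at (third \<rho> p q) \<rho> p' q' rs"
  using assms by (cases \<rho>; simp)+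

lemma nth_kill_cells:
  "length (kill_cells p q t cs) = length cs"
  "i < length cs \<Longrightarrow> kill_cells p q t cs ! i = kill_cell (locate p q (t + i)) (cs ! i)"
  by (induction p q t cs arbitrary: i rule: kill_cells.induct)
    (auto simp: nth_Cons split: nat.splits)

lemma nth_kill_rows:
  "length (kill_rows p q p' q' t rs) = length rs"
  "i < length rs \<Longrightarrow> kill_rows p q p' q' t rs ! i = kill_row p' q' (locate p q (t + i)) (rs ! i)"
  by (induction p q p' q' t rs arbitrary: i rule: kill_rows.induct)
    (auto simp: nth_Cons split: nat.splits)

lemma length_clear_opt [simp]: "length (clear_opt y r) = length r"
  by (cases y) auto

lemma nth_clear_opt:
  "j < length r \<Longrightarrow> clear_opt y r ! j = (if y = Some j then Out else r ! j)"
  by (cases y) (auto simp: nth_list_update_if)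

lemma length_kill_row [simp]: "length (kill_row p q \<rho> r) = length r"
  by (cases \<rho>) (auto simp: nth_kill_cells)

text \<open>The ratio of the heights separates three situations: the line meets the layer in a third
  point whose position is determined, it has no third point there, or it lies inside the layer. In
  the last situation the same trichotomy is repeated for the rows and then for the cells.\<close>

lemma conforms_kill_layer:
  assumes free: "line_free s" and s: "s z x y" "s z' x' y'" and c: "conforms m (s t) rs"
  shows "conforms m (s t) (kill_layer x x' y y' (locate z z' t) rs)"
proof -
  consider (proper) "proper (locate z z' t)" | (apart) "locate z z' t = Apart"
    | (same) "locate z z' t = Same"
    using locate_cases by blast
  then show ?thesis
  proof cases
    case proper
    show ?thesis
    proof (cases "third (locate z z' t) x x'")
      case None
      with proper c show ?thesis by (simp add: kill_proper)
    next
      case (Some u)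
      note u = this
      show ?thesis
      proof (cases "third (locate z z' t) y y'")
        case None
        with proper u c show ?thesis by (simp add: kill_proper)
      next
        case (Some v)
        have "\<not> s t u v"
          by (rule line_freeD[OF free proper s fits_locate fits_third[OF u] fits_third[OF Some]])
            (use proper_locate_distinct[OF proper] in simp)
        with proper u Some c show ?thesis by (simp add: kill_proper conforms_put)
      qed
    qed
  next
    case apart
    with c show ?thesis by simp
  next
    case same
    then have z: "z = t" "z' = t" using locate_Same by auto
    have "admits (kill_row y y' (locate x x' i) (rs ! i) ! j) (s t i j)" if i: "i \<le> m" "j \<le> m" for i j
    proof -
      have l: "length (rs ! i) = Suc m" and a: "admits (rs ! i ! j) (s t i j)"
        using c i by (auto simp: conforms_def)
      consider (proper) "proper (locate x x' i)" | (apart) "locate x x' i = Apart"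
        | (same) "locate x x' i = Same"
        using locate_cases by blast
      then show ?thesis
      proof cases
        case proper
        \<comment> \<open>Equal heights fit any ratio, so the ratio read off from the rows applies
          to all three coordinates.\<close>
        have "fits (locate x x' i) z z' t" by (simp only: z fits_refl)
        then have "\<not> s t i j" if "third (locate x x' i) y y' = Some j"
          by (rule line_freeD[OF free proper s _ fits_locate fits_third[OF that]])
            (use proper_locate_distinct[OF proper] in simp)
        with proper l i a show ?thesis by (simp add: kill_proper nth_clear_opt)
      next
        case apart
        with a show ?thesis by simp
      next
        case same
        then have x: "x = i" "x' = i" using locate_Same by auto
        have f: "fits (locate y y' j) z z' t" "fits (locate y y' j) x x' i"
          by (simp_all only: z x fits_refl)
        have "\<not> s t i j" if p: "proper (locate y y' j)"
          by (rule line_freeD[OF free p s f fits_locate]) (use proper_locate_distinct[OF p] in simp)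
        then show ?thesis
          using same l i a locate_cases[of y y' j] by (auto simp: nth_kill_cells kill_proper)
      qed
    qed
    with c same show ?thesis by (auto simp: conforms_def nth_kill_rows)
  qed
qed

lemma layer_ok_kill:
  assumes "line_free s" "holds s p" "holds s q" "\<forall>L\<in>set G. layer_ok m s L"
  shows "\<forall>L\<in>set (kill p q G). layer_ok m s L"
  using assms by (induction p q G rule: kill.induct) (auto simp: conforms_kill_layer)

lemma layer_ok_kill_all:
  assumes "line_free s" "holds s p" "\<forall>q\<in>set C. holds s q" "\<forall>L\<in>set G. layer_ok m s L"
  shows "\<forall>L\<in>set (kill_all p C G). layer_ok m s L"
  using assms(3,4)
proof (induction C arbitrary: G)
  case (Cons q C)
  then show ?case using layer_ok_kill[OF assms(1,2), of q G m] by simp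
qed simp

lemma layer_ok_mark:
  assumes "case p of Point z x y \<Rightarrow> admits v (s z x y)" "\<forall>L\<in>set G. layer_ok m s L"
  shows "\<forall>L\<in>set (mark v p G). layer_ok m s L"
  using assms
proof (induction v p G rule: mark.induct)
  case (2 v z x y t c rs G)
  have "conforms m (s t) (mark_rows v x y (cmp z t) rs)"
  proof (cases "cmp z t")
    case Equal
    with 2 show ?thesis by (auto dest!: cmp_Equal simp: conforms_put)
  qed (use 2 in auto)
  with 2 show ?case by auto
qed simp

lemma height_kill_all: "map height (kill_all p C G) = map height G"
proof (induction C arbitrary: G)
  case (Cons q C)
  have "map height (kill p q G) = map height G"
    by (induction p q G rule: kill.induct) auto
  with Cons show ?case by simp
qed simp

lemma height_mark: "map height (mark v p G) = map height G"
  by (induction v p G rule: mark.induct) auto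

section \<open>Excluding the lines between two outer layers\<close>

lemma conforms_cross_point:
  assumes "\<And>y' u. y' \<in> set ys' \<Longrightarrow> third \<rho> y y' = Some u \<Longrightarrow> \<not> g x u" "conforms m g rs"
  shows "conforms m g (cross_point \<rho> x y ys' rs)"
  using assms
proof (induction ys' arbitrary: rs)
  case (Cons y' ys')
  have "conforms m g (put_opt x (third \<rho> y y') rs)"
  proof (cases "third \<rho> y y'")
    case (Some u)
    have "\<not> g x u" by (rule Cons.prems(1)[OF _ Some]) simp
    with Some Cons.prems(2) show ?thesis by (simp add: conforms_put)
  qed (use Cons.prems in simp)
  moreover have "\<not> g x u" if "y'' \<in> set ys'" "third \<rho> y y'' = Some u" for y'' u
    by (rule Cons.prems(1)[OF _ that(2)]) (use that(1) in simp)
  ultimately have "conforms m g (cross_point \<rho> x y ys' (put_opt x (third \<rho> y y') rs))"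
    by (intro Cons.IH) blast+
  then show ?case by simp
qed simp

lemma conforms_cross_row:
  assumes "\<And>y y' u v. y \<in> set ys \<Longrightarrow> y' \<in> set ys' \<Longrightarrow> x = Some u \<Longrightarrow> third \<rho> y y' = Some v \<Longrightarrow> \<not> g u v"
    and "conforms m g rs"
  shows "conforms m g (cross_row x \<rho> ys ys' rs)"
  using assms
proof (induction x \<rho> ys ys' rs rule: cross_row.induct)
  case (3 x \<rho> y ys ys' rs)
  have "conforms m g (cross_point \<rho> x y ys' rs)"
    using 3(2)[of y] 3(3) by (intro conforms_cross_point) auto
  moreover have "\<not> g u v"
    if "y'' \<in> set ys" "y' \<in> set ys'" "Some x = Some u" "third \<rho> y'' y' = Some v" for y'' y' u v
    by (rule 3(2)[OF _ that(2-4)]) (use that(1) in simp)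
  ultimately show ?case using 3(1) by simp
qed simp_all

lemma conforms_cross_rows:
  assumes "\<And>i y y' u v. i < length B \<Longrightarrow> y \<in> set ys \<Longrightarrow> y' \<in> set (B ! i) \<Longrightarrow>
      third \<rho> x (x' + i) = Some u \<Longrightarrow> third \<rho> y y' = Some v \<Longrightarrow> \<not> g u v"
    and "conforms m g rs"
  shows "conforms m g (cross_rows \<rho> x ys x' B rs)"
  using assms
proof (induction \<rho> x ys x' B rs rule: cross_rows.induct)
  case (2 \<rho> x ys x' ys' B rs)
  have "conforms m g (cross_row (third \<rho> x x') \<rho> ys ys' rs)"
    using 2(2)[of 0] 2(3) by (intro conforms_cross_row) auto
  moreover have "\<not> g u v" if "i < length B" "y \<in> set ys" "y' \<in> set (B ! i)"
      "third \<rho> x (Suc x' + i) = Some u" "third \<rho> y y' = Some v" for i y y' u v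
    using 2(2)[of "Suc i" y y' u v] that by simp
  ultimately show ?case using 2(1) by simp
qed simp

lemma conforms_cross_layer:
  assumes "\<And>i j y y' u v. i < length A \<Longrightarrow> j < length B \<Longrightarrow> y \<in> set (A ! i) \<Longrightarrow> y' \<in> set (B ! j) \<Longrightarrow>
      third \<rho> (x + i) j = Some u \<Longrightarrow> third \<rho> y y' = Some v \<Longrightarrow> \<not> g u v"
    and "conforms m g rs"
  shows "conforms m g (cross_layer \<rho> x A B rs)"
  using assms
proof (induction \<rho> x A B rs rule: cross_layer.induct)
  case (2 \<rho> x ys A B rs)
  have "conforms m g (cross_rows \<rho> x ys 0 B rs)"
    using 2(2)[of 0] 2(3) by (intro conforms_cross_rows) auto
  moreover have "\<not> g u v" if "i < length A" "j < length B" "y \<in> set (A ! i)" "y' \<in> set (B ! j)"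
      "third \<rho> (Suc x + i) j = Some u" "third \<rho> y y' = Some v" for i j y y' u v
    using 2(2)[of "Suc i" j y y' u v] that by simp
  ultimately show ?case using 2(1) by simp
qed simp

lemma row_positions_In:
  "y' \<in> set (row_positions y r) \<Longrightarrow> \<exists>j < length r. y' = y + j \<and> r ! j = In"
  by (induction y r rule: row_positions.induct) (auto simp: less_Suc_eq_0_disj)

lemma positions_nth:
  "length (positions rs) = length rs"
  "i < length rs \<Longrightarrow> positions rs ! i = row_positions 0 (rs ! i)"
  by (induction rs arbitrary: i) (auto simp: nth_Cons split: nat.splits)

lemma conforms_positions:
  assumes "conforms m g rs" "i < length (positions rs)" "y \<in> set (positions rs ! i)"
  shows "g i y"
proof -
  have "i \<le> m" "y \<in> set (row_positions 0 (rs ! i))"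
    using assms by (auto simp: conforms_def positions_nth)
  moreover from this obtain j where "j < length (rs ! i)" "y = j" "rs ! i ! j = In"
    using row_positions_In by fastforce
  ultimately show ?thesis
    using assms(1) by (metis admits.simps(1) conforms_def less_Suc_eq_le)
qed

lemma layer_ok_cross:
  assumes "line_free s" "conforms m (s 0) A" "conforms m (s m) B" "\<forall>L\<in>set G. layer_ok m s L"
  shows "\<forall>L\<in>set (cross m (positions A) (positions B) G). layer_ok m s L"
proof -
  have "conforms m (s t) (cross_layer (locate 0 m t) 0 (positions A) (positions B) rs)"
    if "conforms m (s t) rs" for t rs
  proof (rule conforms_cross_layer[OF _ that])
    fix i j y y' u v
    assume *: "i < length (positions A)" "j < length (positions B)"
      "y \<in> set (positions A ! i)" "y' \<in> set (positions B ! j)"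
      and t: "third (locate 0 m t) (0 + i) j = Some u" "third (locate 0 m t) y y' = Some v"
    have "s 0 i y" "s m j y'"
      using conforms_positions[OF assms(2)] conforms_positions[OF assms(3)] * by auto
    \<comment> \<open>A third coordinate exists only for a proper ratio, and a proper ratio of the
      heights forces \<open>0 \<noteq> m\<close>, so the bottom and top points are distinct.\<close>
    then show "\<not> s t u v"
      using line_freeD[OF assms(1) third_locate_proper[OF t(1)] _ _ fits_locate
          fits_third[OF t(1)] fits_third[OF t(2)]]
        proper_locate_distinct[OF third_locate_proper[OF t(1)]] by simp
  qed
  then show ?thesis
    using assms(4)
  proof (induction G)
    case (Cons L G)
    then show ?case by (cases L) simp
  qed simp
qed

lemma points_of_row_In:
  "p \<in> set (points_of_row z x y r ps) \<Longrightarrow>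
    p \<in> set ps \<or> (\<exists>j < length r. p = Point z x (y + j) \<and> r ! j = In)"
  by (induction z x y r ps rule: points_of_row.induct) (auto simp: less_Suc_eq_0_disj)

lemma points_of_In:
  "p \<in> set (points_of z x rs) \<Longrightarrow>
    \<exists>i < length rs. \<exists>j < length (rs ! i). p = Point z (x + i) j \<and> rs ! i ! j = In"
proof (induction z x rs rule: points_of.induct)
  case (2 z x r rs)
  from points_of_row_In[of p z x 0 r "points_of z (Suc x) rs"] 2(2)
  consider "p \<in> set (points_of z (Suc x) rs)" | j where "j < length r" "p = Point z x j" "r ! j = In"
    by auto
  then show ?case
  proof cases
    case 1
    then obtain i j where "i < length rs" "j < length (rs ! i)" "p = Point z (Suc x + i) j" "rs ! i ! j = In"
      using 2(1) by blast
    then show ?thesis by (intro exI[of _ "Suc i"]) auto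
  next
    case 2
    then show ?thesis by (intro exI[of _ 0]) auto
  qed
qed simp

lemma holds_points_of:
  assumes "conforms m (s z) rs" "p \<in> set (points_of z 0 rs)"
  shows "holds s p"
proof -
  obtain i j where "i < length rs" "j < length (rs ! i)" "p = Point z i j" "rs ! i ! j = In"
    using points_of_In[OF assms(2)] by auto
  then show ?thesis
    using assms(1) by (metis admits.simps(1) conforms_def holds.simps less_Suc_eq_le)
qed

text \<open>The height and one horizontal coordinate are constant along a row or column and fit any
  ratio. Three positions \<open>a < b < c\<close> on it fit \<open>Beyond (c - b) (b - a)\<close>
  and contradict \<open>line_free\<close>.\<close>

lemma line_total_le_2:
  assumes "config m s" "z \<le> m"
  shows "x \<le> m \<Longrightarrow> (\<Sum>y = 0..m. of_bool (s z x y)) \<le> (2::nat)"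
    and "y \<le> m \<Longrightarrow> (\<Sum>x = 0..m. of_bool (s z x y)) \<le> (2::nat)"
proof -
  have free: "line_free s" using assms by (simp add: config_def)
  have three: "\<exists>a b c. a \<in> A \<and> b \<in> A \<and> c \<in> A \<and> a < b \<and> b < c" if c: "3 \<le> card A" for A :: "nat set"
  proof -
    obtain B where "B \<subseteq> A" "card B = 3" using obtain_subset_with_card_n[OF c] by metis
    then obtain a b c where "B = {a, b, c}" "a \<noteq> b" "b \<noteq> c" "a \<noteq> c" by (metis card_3_iff)
    with \<open>B \<subseteq> A\<close> have "a \<in> A" "b \<in> A" "c \<in> A" by auto
    with \<open>a \<noteq> b\<close> \<open>b \<noteq> c\<close> \<open>a \<noteq> c\<close> show ?thesis by (metis linorder_neqE_nat)
  qed
  have small: "(\<Sum>i = 0..m. of_bool (P i)) \<le> (2::nat)"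
    if "\<And>a b c. P a \<Longrightarrow> P b \<Longrightarrow> P c \<Longrightarrow> a < b \<Longrightarrow> b < c \<Longrightarrow> False" for P
  proof (rule ccontr)
    assume "\<not> (\<Sum>i = 0..m. of_bool (P i)) \<le> (2::nat)"
    moreover have "(\<Sum>i = 0..m. of_bool (P i)) = card ({0..m} \<inter> {i. P i})"
      by simp
    ultimately have "3 \<le> card ({0..m} \<inter> {i. P i})" by simp
    from three[OF this] that show False by blast
  qed
  have beyond: "proper (Beyond (c - b) (b - a))" "fits (Beyond (c - b) (b - a)) a b c"
    if "a < b" "b < c" for a b c :: nat
  proof -
    obtain d e where "b = a + d" "c = b + e" using \<open>a < b\<close> \<open>b < c\<close> by (metis less_imp_add_positive)
    with that show "proper (Beyond (c - b) (b - a))" "fits (Beyond (c - b) (b - a)) a b c"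
      by (auto simp: algebra_simps)
  qed
  show "x \<le> m \<Longrightarrow> (\<Sum>y = 0..m. of_bool (s z x y)) \<le> (2::nat)"
    using line_freeD[OF free beyond(1) _ _ fits_refl fits_refl beyond(2)] by (intro small) blast
  show "y \<le> m \<Longrightarrow> (\<Sum>x = 0..m. of_bool (s z x y)) \<le> (2::nat)"
    using line_freeD[OF free beyond(1) _ _ fits_refl beyond(2) fits_refl] by (intro small) blast
qed

section \<open>Row and column deficits\<close>

lemma row_info_eq: "fst (row_info a u r) = a + length (filter (\<lambda>c. c \<noteq> Out) r)"
  by (induction a u r rule: row_info.induct) auto

lemma deficit_Cons: "deficit (i # l) = (2 - fst i) + deficit l"
  by (cases i; cases "fst i"; cases "fst i - 1") auto

lemma deficit_row_infos:
  "deficit (row_infos rs) = (\<Sum>x<length rs. 2 - length (filter (\<lambda>c. c \<noteq> Out) (rs ! x)))"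
proof -
  have "deficit (row_infos rs) = (\<Sum>r\<leftarrow>rs. 2 - length (filter (\<lambda>c. c \<noteq> Out) r))"
    by (induction rs) (auto simp: deficit_Cons row_info_eq)
  then show ?thesis by (simp add: sum_list_sum_nth atLeast0LessThan)
qed

text \<open>A row with \<open>a\<close> cells not marked \<open>Out\<close> lacks at least
  \<open>2 - a\<close> points. The true shortfalls sum to exactly \<open>c\<close>, because no row
  exceeds two points and the truncated differences are therefore exact.\<close>

lemma deficit_le:
  assumes "conforms m g rs" "\<And>x. x \<le> m \<Longrightarrow> (\<Sum>y = 0..m. of_bool (g x y)) \<le> (2::nat)"
    and "layer_total m g + c = 2 * Suc m"
  shows "deficit (row_infos rs) \<le> c"
proof -
  have "(\<Sum>y = 0..m. of_bool (g x y)) \<le> length (filter (\<lambda>c. c \<noteq> Out) (rs ! x))" if "x \<le> m" for x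
  proof -
    have "(\<Sum>y = 0..m. of_bool (g x y)) = card ({0..m} \<inter> {y. g x y})" by simp
    also have "\<dots> \<le> card {i. i < length (rs ! x) \<and> rs ! x ! i \<noteq> Out}"
    proof (rule card_mono)
      show "{0..m} \<inter> {y. g x y} \<subseteq> {i. i < length (rs ! x) \<and> rs ! x ! i \<noteq> Out}"
      proof
        fix y assume y: "y \<in> {0..m} \<inter> {y. g x y}"
        then have "y \<le> m" by simp
        then have "admits (rs ! x ! y) (g x y)" "length (rs ! x) = Suc m"
          using assms(1) that by (simp_all add: conforms_def)
        with y show "y \<in> {i. i < length (rs ! x) \<and> rs ! x ! i \<noteq> Out}"
          by (cases "rs ! x ! y") auto
      qed
    qed simp
    also have "\<dots> = length (filter (\<lambda>c. c \<noteq> Out) (rs ! x))"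
      by (simp add: length_filter_conv_card)
    finally show ?thesis .
  qed
  then have "deficit (row_infos rs) \<le> (\<Sum>x = 0..m. 2 - (\<Sum>y = 0..m. of_bool (g x y)))"
    using assms(1) unfolding deficit_row_infos
    by (auto simp: conforms_def atLeast0AtMost lessThan_Suc_atMost intro!: sum_mono diff_le_mono2)
  moreover have "(\<Sum>x = 0..m. 2 - (\<Sum>y = 0..m. of_bool (g x y))) + layer_total m g = (\<Sum>x = 0..m. 2)"
    unfolding layer_total_def sum.distrib [symmetric] by (intro sum.cong refl) (use assms(2) in auto)
  ultimately show ?thesis using assms(3) by simp
qed

text \<open>The alternative \<open>ls = []\<close> is the last row, which
  \<open>transpose_rows\<close> joins to the empty list.\<close>

lemma nth_zip_cons:
  assumes "length ls = length cs \<or> ls = []"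
  shows "length (zip_cons cs ls) = length cs"
    and "i < length cs \<Longrightarrow> zip_cons cs ls ! i = cs ! i # (if ls = [] then [] else ls ! i)"
  using assms
  by (induction cs ls arbitrary: i rule: zip_cons.induct) (auto simp: nth_Cons split: nat.splits)

lemma nth_transpose_rows:
  assumes "\<And>r. r \<in> set rs \<Longrightarrow> length r = n" "rs \<noteq> []"
  shows "length (transpose_rows rs) = n" "i < n \<Longrightarrow> length (transpose_rows rs ! i) = length rs"
    "i < n \<Longrightarrow> j < length rs \<Longrightarrow> transpose_rows rs ! i ! j = rs ! j ! i"
proof -
  have "length (transpose_rows rs) = n \<and> (\<forall>i<n. length (transpose_rows rs ! i) = length rs \<and>
      (\<forall>j<length rs. transpose_rows rs ! i ! j = rs ! j ! i))"
    using assms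
  proof (induction rs)
    case (Cons r rs)
    show ?case
    proof (cases "rs = []")
      case True
      with Cons.prems show ?thesis by (auto simp: nth_zip_cons)
    next
      case False
      with Cons have IH: "length (transpose_rows rs) = n" "\<forall>i<n. length (transpose_rows rs ! i) = length rs \<and>
          (\<forall>j<length rs. transpose_rows rs ! i ! j = rs ! j ! i)"
        by auto
      have r: "length r = n" using Cons.prems by simp
      show ?thesis
      proof (cases "n = 0")
        case False
        then have "transpose_rows rs \<noteq> []" using IH(1) by auto
        with IH r show ?thesis by (auto simp: nth_zip_cons nth_Cons split: nat.splits)
      qed (use r IH in \<open>auto simp: nth_zip_cons\<close>)
    qed
  qed simp
  then show "length (transpose_rows rs) = n" "i < n \<Longrightarrow> length (transpose_rows rs ! i) = length rs"
    "i < n \<Longrightarrow> j < length rs \<Longrightarrow> transpose_rows rs ! i ! j = rs ! j ! i" by auto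
qed

lemma conforms_transpose_rows:
  assumes "conforms m g rs"
  shows "conforms m (\<lambda>x y. g y x) (transpose_rows rs)"
proof -
  have l: "length rs = Suc m" "length r = Suc m" if "r \<in> set rs" for r
    using assms that by (auto simp: conforms_def in_set_conv_nth less_Suc_eq_le)
  have "length rs = Suc m" using assms by (simp add: conforms_def)
  moreover from this have "rs \<noteq> []" by auto
  ultimately show ?thesis
    using assms nth_transpose_rows[OF l(2)] by (auto simp: conforms_def less_Suc_eq_le)
qed

lemma inspect_layer_dead:
  assumes "config m s" "layer_ok m s (Layer z c rs)" "z \<le> m"
  shows "inspect_layer b z c rs (transpose_rows rs) (row_infos rs) \<noteq> None"
proof -
  have rs: "conforms m (s z) rs" and c: "layer_total m (s z) + c = 2 * Suc m"
    using assms(2) by auto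
  have "layer_total m (\<lambda>x y. s z y x) = layer_total m (s z)"
    unfolding layer_total_def by (rule sum.swap)
  then have "deficit (row_infos rs) \<le> c" "deficit (row_infos (transpose_rows rs)) \<le> c"
    using c line_total_le_2[OF assms(1,3)]
    by (auto intro!: deficit_le[OF rs] deficit_le[OF conforms_transpose_rows[OF rs]])
  then show ?thesis by (simp add: minus_opt_eq)
qed

lemma inspect_dead:
  assumes "config m s" "\<forall>L\<in>set G. layer_ok m s L \<and> height L \<le> m"
  shows "inspect (Some b) G \<noteq> None"
  using assms(2)
proof (induction G arbitrary: b)
  case (Cons L G)
  obtain z c rs where L: "L = Layer z c rs" by (cases L)
  have "inspect_layer b z c rs (transpose_rows rs) (row_infos rs) \<noteq> None"
    using Cons.prems assms(1) by (intro inspect_layer_dead) (auto simp: L)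
  then obtain b' where "inspect_layer b z c rs (transpose_rows rs) (row_infos rs) = Some b'" by blast
  with Cons L show ?case by simp
qed simp

text \<open>The configuration selects the branch: membership of the split point decides which half
  to follow. Heights are carried along because they bound the slices of \<open>s\<close> that are
  inspected and identify the layers of the final state. That the verdict is not \<open>Dead\<close>
  comes from \<open>inspect_dead\<close>.\<close>

lemma solve_complete:
  assumes "config m s"
  shows "\<forall>p\<in>set C. holds s p \<Longrightarrow> \<forall>L\<in>set G. layer_ok m s L \<and> height L \<le> m \<Longrightarrow>
      \<exists>G'\<in>set (solve f C G). (\<forall>L\<in>set G'. layer_ok m s L) \<and> map height G' = map height G"
    and "\<forall>p\<in>set C. holds s p \<Longrightarrow> \<forall>L\<in>set G. layer_ok m s L \<and> height L \<le> m \<Longrightarrow> v \<noteq> Dead \<Longrightarrow>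
      \<exists>G'\<in>set (branch f C G v). (\<forall>L\<in>set G'. layer_ok m s L) \<and> map height G' = map height G"
proof (induction f C G and f C G v rule: solve_branch.induct)
  case (2 f C G)
  obtain b where "inspect (Some NoChoice) G = Some b"
    using inspect_dead[OF assms 2(3)] by auto
  then have "verdict_of (inspect (Some NoChoice) G) \<noteq> Dead" by (cases b) auto
  with 2 show ?case by simp
next
  case (5 f C G p)
  have free: "line_free s" using assms by (simp add: config_def)
  have heights: "\<forall>L\<in>set G'. height L \<le> m" if "map height G' = map height G" for G'
  proof -
    have "height ` set G' = height ` set G" using that by (metis list.set_map)
    with 5(4) show ?thesis by (metis (no_types, lifting) image_iff)
  qed
  show ?case
  proof (cases "holds s p")
    case True
    let ?G = "kill_all p C (mark In p G)"
    have "\<forall>L\<in>set (mark In p G). layer_ok m s L"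
      using True 5(4) by (intro layer_ok_mark) (cases p; auto)+
    then have "\<forall>L\<in>set ?G. layer_ok m s L"
      by (rule layer_ok_kill_all[OF free True 5(3)])
    moreover have h: "map height ?G = map height G"
      by (simp add: height_kill_all height_mark)
    ultimately obtain G' where "G' \<in> set (solve f (p # C) ?G)" "\<forall>L\<in>set G'. layer_ok m s L"
      "map height G' = map height G"
      using 5(1) 5(3) True heights[OF h] by auto
    then show ?thesis by auto
  next
    case False
    let ?G = "mark Out p G"
    have "\<forall>L\<in>set ?G. layer_ok m s L"
      using False 5(4) by (intro layer_ok_mark) (cases p; auto)+
    moreover have h: "map height ?G = map height G"
      by (simp add: height_mark)
    ultimately obtain G' where "G' \<in> set (solve f C ?G)" "\<forall>L\<in>set G'. layer_ok m s L"
      "map height G' = map height G"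
      using 5(2) 5(3) heights[OF h] by auto
    then show ?thesis by auto
  qed
qed auto

section \<open>Completeness of the list of outer layers\<close>

lemma length_copies [simp]: "length (copies n c) = n"
  by (induction n) auto

lemma nth_copies [simp]: "i < n \<Longrightarrow> copies n c ! i = c"
  by (induction n arbitrary: i) (auto simp: nth_Cons split: nat.splits)

lemma layer_ok_open_layer:
  "layer_total m (s z) + c = 2 * Suc m \<Longrightarrow> layer_ok m s (open_layer (Suc m) c z)"
  by (simp add: conforms_def del: copies.simps)

lemma rows_of_Layer: "(Layer z c rs # G) \<in> set l \<Longrightarrow> rs \<in> set (rows_of l)"
  by (induction l rule: rows_of.induct) auto

lemma full_layers_complete:
  assumes "config m s"
  shows "\<exists>A\<in>set (full_layers (Suc m)). conforms m (s 0) A"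
proof -
  have "layer_total m (s 0) + 0 = 2 * Suc m" using assms by (simp add: config_def)
  then have "\<forall>L\<in>set [open_layer (Suc m) 0 0]. layer_ok m s L \<and> height L \<le> m"
    using layer_ok_open_layer[of m s 0 0] by (simp del: copies.simps layer_ok.simps)
  from solve_complete(1)[OF assms _ this, of "[]" "Suc m * Suc m"] obtain G where
    G: "G \<in> set (solve (Suc m * Suc m) [] [open_layer (Suc m) 0 0])"
    "\<forall>L\<in>set G. layer_ok m s L" "map height G = [0]"
    by auto
  then obtain c rs where "G = [Layer 0 c rs]"
    by (auto simp: map_eq_Cons_conv) (metis height.simps layer.exhaust)
  with G rows_of_Layer show ?thesis unfolding full_layers_def by fastforce
qed

section \<open>Symmetries of configurations\<close>

lemma fits_map:
  assumes "f = id \<or> f = (\<lambda>i. m - i)" "p \<le> m" "q \<le> m" "t \<le> m" "fits \<rho> p q t"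
  shows "fits \<rho> (f p) (f q) (f t)"
  using assms fits_reflect[of "m - p" m "m - q" "m - t" \<rho>] by auto

text \<open>A violation in \<open>s'\<close> is carried to one in \<open>s\<close>: reflections
  preserve ratios and are injective on the coordinates up to \<open>m\<close>.\<close>

lemma line_free_map:
  assumes "line_free s"
    and "\<And>z x y. s' z x y \<Longrightarrow> z \<le> m \<and> x \<le> m \<and> y \<le> m \<and> s (a z) (b x) (c y)"
    and abc: "a = id \<or> a = (\<lambda>i. m - i)" "b = id \<or> b = (\<lambda>i. m - i)" "c = id \<or> c = (\<lambda>i. m - i)"
  shows "line_free s'"
  unfolding line_free_def
proof (intro allI impI)
  fix \<rho> x y z x' y' z' u v w
  assume \<rho>: "proper \<rho>" and s: "s' z x y" "s' z' x' y'" "s' w u v"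
    and f: "fits \<rho> z z' w" "fits \<rho> x x' u" "fits \<rho> y y' v"
  have le: "z \<le> m" "x \<le> m" "y \<le> m" "z' \<le> m" "x' \<le> m" "y' \<le> m" "w \<le> m" "u \<le> m" "v \<le> m"
    using s assms(2) by blast+
  have inj: "i = j" if "h i = h j" "i \<le> m" "j \<le> m" "h = id \<or> h = (\<lambda>i. m - i)" for h i j
    using that by auto
  have "a z = a z' \<and> b x = b x' \<and> c y = c y'"
    using assms(1)[unfolded line_free_def, rule_format, OF \<rho> _ _ _
        fits_map[OF abc(1) le(1,4,7) f(1)] fits_map[OF abc(2) le(2,5,8) f(2)]
        fits_map[OF abc(3) le(3,6,9) f(3)]]
      assms(2)[OF s(1)] assms(2)[OF s(2)] assms(2)[OF s(3)] by blast
  then show "z = z' \<and> x = x' \<and> y = y'"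
    using inj[OF _ le(1,4) abc(1)] inj[OF _ le(2,5) abc(2)] inj[OF _ le(3,6) abc(3)] by blast
qed

text \<open>Without the guard, truncated subtraction would send every \<open>x > m\<close> to row
  0.\<close>

definition reflect1 :: "nat \<Rightarrow> (nat \<Rightarrow> 'a \<Rightarrow> bool) \<Rightarrow> nat \<Rightarrow> 'a \<Rightarrow> bool" where
  "reflect1 m g x y \<longleftrightarrow> x \<le> m \<and> g (m - x) y"

definition reflect2 :: "nat \<Rightarrow> (nat \<Rightarrow> nat \<Rightarrow> bool) \<Rightarrow> nat \<Rightarrow> nat \<Rightarrow> bool" where
  "reflect2 m g x y \<longleftrightarrow> y \<le> m \<and> g x (m - y)"

lemma sum_reflect: "(\<Sum>i = 0..m. h (m - i)) = (\<Sum>i = 0..m. h i)" for h :: "nat \<Rightarrow> nat"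
  using sum.atLeastAtMost_rev[of h 0 m] by (simp only: add_0_right)

lemma layer_total_reflect1: "layer_total m (reflect1 m g) = layer_total m g"
  unfolding layer_total_def reflect1_def
  by (rule trans [OF _ sum_reflect [of "\<lambda>x. \<Sum>y = 0..m. of_bool (g x y)" m]], rule sum.cong) auto

lemma layer_total_reflect2: "layer_total m (reflect2 m g) = layer_total m g"
proof -
  have "(\<Sum>y = 0..m. of_bool (y \<le> m \<and> g x (m - y))) = (\<Sum>y = 0..m. of_bool (g x y) :: nat)" for x
    by (rule trans [OF _ sum_reflect [of "\<lambda>y. of_bool (g x y)" m]], rule sum.cong) auto
  then show ?thesis by (simp only: layer_total_def reflect2_def)
qed

lemma layer_total_transpose: "layer_total m (\<lambda>x y. g y x) = layer_total m g"
  unfolding layer_total_def by (rule sum.swap)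

lemma config_reflect_height:
  assumes "config m s"
  shows "config m (\<lambda>z x y. z \<le> m \<and> s (m - z) x y)"
proof -
  have "line_free (\<lambda>z x y. z \<le> m \<and> s (m - z) x y)"
    by (rule line_free_map[of s _ m "\<lambda>i. m - i" id id])
      (use assms in \<open>auto simp: config_def\<close>)
  moreover have "(\<lambda>x y. z \<le> m \<and> s (m - z) x y) = s (m - z)" if "z \<le> m" for z
    using that by simp
  ultimately show ?thesis using assms by (auto simp: config_def)
qed

lemma config_reflect1:
  assumes "config m s"
  shows "config m (\<lambda>z. reflect1 m (s z))"
proof -
  have "line_free (\<lambda>z. reflect1 m (s z))"
    by (rule line_free_map[of s _ m id "\<lambda>i. m - i" id])
      (use assms in \<open>auto simp: config_def reflect1_def\<close>)
  with assms show ?thesis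
    by (auto simp: config_def layer_total_reflect1) (auto simp: reflect1_def)
qed

lemma config_reflect2:
  assumes "config m s"
  shows "config m (\<lambda>z. reflect2 m (s z))"
proof -
  have "line_free (\<lambda>z. reflect2 m (s z))"
    by (rule line_free_map[of s _ m id id "\<lambda>i. m - i"])
      (use assms in \<open>auto simp: config_def reflect2_def\<close>)
  with assms show ?thesis
    by (auto simp: config_def layer_total_reflect2) (auto simp: reflect2_def)
qed

lemma config_transpose:
  assumes "config m s"
  shows "config m (\<lambda>z x y. s z y x)"
proof -
  have "line_free (\<lambda>z x y. s z y x)"
    using assms unfolding config_def line_free_def by blast
  moreover have "layer_total m (\<lambda>x y. s z y x) = layer_total m (s z)" for z
    by (rule layer_total_transpose)
  ultimately show ?thesis
    using assms by (auto simp: config_def)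
qed

lemma conforms_rev: "conforms m g A \<Longrightarrow> conforms m (reflect1 m g) (rev A)"
  by (auto simp: conforms_def reflect1_def rev_nth)

lemma conforms_map_rev: "conforms m g A \<Longrightarrow> conforms m (reflect2 m g) (map rev A)"
  by (auto simp: conforms_def reflect2_def rev_nth)

text \<open>A symmetry of the square, applied to all layers at once, turns a configuration with
  bottom \<open>B\<close> into one with bottom \<open>A\<close>.\<close>

lemma orbit_excluded:
  assumes "A \<in> set (orbit B)" "\<And>s. config m s \<Longrightarrow> \<not> conforms m (s 0) A"
    and "config m s"
  shows "\<not> conforms m (s 0) B"
proof
  assume B: "conforms m (s 0) B"
  have flips: "\<exists>s'. config m s' \<and> conforms m (s' 0) C" if "C \<in> set (flips B)" for C
  proof -
    consider "C = B" | "C = rev B" | "C = map rev B" | "C = map rev (rev B)"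
      using \<open>C \<in> set (flips B)\<close> by (auto simp: rev_map)
    then show ?thesis
    proof cases
      case 1 with B assms(3) show ?thesis by blast
    next
      case 2
      with conforms_rev[OF B] config_reflect1[OF assms(3)] show ?thesis by blast
    next
      case 3
      with conforms_map_rev[OF B] config_reflect2[OF assms(3)] show ?thesis by blast
    next
      case 4
      with conforms_map_rev[OF conforms_rev[OF B]] config_reflect2[OF config_reflect1[OF assms(3)]]
      show ?thesis by blast
    qed
  qed
  have "A \<in> set (flips B) \<or> (\<exists>C\<in>set (flips B). A = transpose_rows C)"
    using assms(1) by (auto simp del: flips.simps)
  with flips assms(2) conforms_transpose_rows config_transpose show False by metis
qed

section \<open>Soundness of the symmetry reduction\<close>

lemma eq_row: "eq_row a b \<Longrightarrow> a = b"
  by (induction a b rule: eq_row.induct) auto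

lemma eq_rows: "eq_rows a b \<Longrightarrow> a = b" "eq_rows_rest c a b \<Longrightarrow> a = b \<and> c"
  by (induction a b and c a b rule: eq_rows_eq_rows_rest.induct) (auto dest: eq_row)

lemma mem_rows:
  "mem_rows a bs \<Longrightarrow> a \<in> set bs" "mem_rows_rest c a bs \<Longrightarrow> c \<or> a \<in> set bs"
  by (induction a bs and c a bs rule: mem_rows_mem_rows_rest.induct) (auto dest: eq_rows(1))

text \<open>The second part is the invariant of the auxiliary function, where \<open>d\<close> is
  the outcome of the membership test for the head \<open>c\<close>.\<close>

lemma remove_orbit:
  "b \<in> set L \<Longrightarrow> b \<in> set (remove_orbit a L) \<or> a \<in> set (orbit b)"
  "b = c \<or> b \<in> set L \<Longrightarrow> (d \<Longrightarrow> a \<in> set (orbit c)) \<Longrightarrow>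
     b \<in> set (remove_head d a c L) \<or> a \<in> set (orbit b)"
  by (induction a L and d a c L rule: remove_orbit_remove_head.induct)
    (auto dest: mem_rows(1) simp del: orbit.simps)

lemma is_Nil: "is_Nil xs \<longleftrightarrow> xs = []"
  by (cases xs) auto

lemma not_pairs_excluded:
  assumes "config m s" "conforms m (s 0) A" "conforms m (s m) B" "B \<in> set L"
    and "\<forall>L\<in>set G. layer_ok m s L \<and> height L \<le> m"
  shows "\<not> pairs_excluded f m (points_of 0 0 A) (positions A) G L"
  using assms(4)
proof (induction L)
  case (Cons B' L)
  have "solve f (points_of 0 0 A @ points_of m 0 B) (cross m (positions A) (positions B) G) \<noteq> []"
  proof -
    have h: "map height (cross m (positions A) (positions B) G) = map height G"
    proof (induction G)
      case (Cons L G)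
      then show ?case by (cases L) simp
    qed simp
    have "\<forall>L\<in>set (cross m (positions A) (positions B) G). layer_ok m s L"
      by (rule layer_ok_cross) (use assms in \<open>auto simp: config_def\<close>)
    moreover have "\<forall>L\<in>set (cross m (positions A) (positions B) G). height L \<le> m"
    proof -
      have "height ` set (cross m (positions A) (positions B) G) = height ` set G"
        using h by (metis list.set_map)
      then show ?thesis using assms(5) by (metis (no_types, lifting) image_iff)
    qed
    moreover have "\<forall>p\<in>set (points_of 0 0 A @ points_of m 0 B). holds s p"
      using holds_points_of assms(2,3) by auto
    ultimately have "\<exists>G'\<in>set (solve f (points_of 0 0 A @ points_of m 0 B)
        (cross m (positions A) (positions B) G)). (\<forall>L\<in>set G'. layer_ok m s L) \<and>
        map height G' = map height (cross m (positions A) (positions B) G)"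
      by (intro solve_complete(1)[OF assms(1)]) blast+
    then show ?thesis by (metis empty_iff list.set(1))
  qed
  then have "\<not> pairs_excluded f m (points_of 0 0 A) (positions A) G (B' # L)" if "B = B'"
    using that by (simp add: is_Nil)
  with Cons show ?case by auto
qed simp

text \<open>The invariant is that the bottom layer of every configuration is described by a member
  of \<open>L\<close>. It is quantified over all configurations so that it can be applied to
  reflected and rotated copies of \<open>s\<close>.\<close>

lemma full_layers_excluded_sound:
  assumes "full_layers_excluded n f m G L"
    and "\<And>s. config m s \<Longrightarrow> \<exists>A\<in>set L. conforms m (s 0) A"
    and G: "\<And>s. config m s \<Longrightarrow> \<forall>L\<in>set G. layer_ok m s L \<and> height L \<le> m"
  shows "\<not> config m s"
  using assms
proof (induction n f m G L arbitrary: s rule: full_layers_excluded.induct)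
  case (1 f m G L)
  then show ?case by (auto simp: is_Nil)
next
  case (2 n f m G)
  then show ?case by auto
next
  case (3 n f m G A L)
  have r: "pairs_excluded f m (points_of 0 0 A) (positions A) G (A # L)" "full_layers_excluded n f m G (remove_orbit A L)"
    using 3(2) by simp_all
  have A: "\<not> conforms m (s 0) A" if c: "config m s" for s
  proof
    assume "conforms m (s 0) A"
    \<comment> \<open>The bottom of the configuration turned upside down is the top of
      \<open>s\<close>, so the top is also found in the list.\<close>
    moreover obtain B where "B \<in> set (A # L)" "conforms m (s m) B"
      using 3(3)[OF config_reflect_height[OF c]] by auto
    ultimately show False
      using not_pairs_excluded[OF c _ _ _ 3(4)[OF c]] r(1) by blast
  qed
  have "\<exists>B\<in>set (remove_orbit A L). conforms m (s 0) B" if c: "config m s" for s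
  proof -
    obtain B where B: "B \<in> set (A # L)" "conforms m (s 0) B"
      using 3(3)[OF c] by blast
    then have "B \<in> set L" using A[OF c] by auto
    moreover have "A \<notin> set (orbit B)"
      using orbit_excluded[of A B m s] A c B(2) by blast
    ultimately show ?thesis using remove_orbit(1) B(2) by blast
  qed
  then show ?case using 3(1)[OF r(2) _ 3(4)] by blast
qed

lemma not_config_if_impossible:
  assumes "impossible m zs" "\<And>z. z \<in> set zs \<Longrightarrow> 0 < z \<and> z < m"
  shows "\<not> config m s"
  using assms(1) unfolding impossible_def
proof (rule full_layers_excluded_sound)
  fix s assume s: "config m s"
  show "\<exists>A\<in>set (full_layers (Suc m)). conforms m (s 0) A"
    by (rule full_layers_complete[OF s])
  have "layer_total m (s z) + Suc (Suc 0) = 2 * Suc m" if "z \<in> set zs" for z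
    using s assms(2)[OF that] by (simp add: config_def)
  then have "layer_ok m s (open_layer (Suc m) (Suc (Suc 0)) z)" if "z \<in> set zs" for z
    using that layer_ok_open_layer by blast
  then show "\<forall>L\<in>set (map (open_layer (Suc m) (Suc (Suc 0))) zs). layer_ok m s L \<and> height L \<le> m"
    using assms(2) by (force simp del: layer_ok.simps)
qed

section \<open>Transfer to Euclidean space\<close>

text \<open>The affine parameter of the third point on the line. The values at \<open>Apart\<close>
  and \<open>Same\<close> are placeholders.\<close>

fun coefficient :: "ratio \<Rightarrow> real" where
  "coefficient (Between m k) = real m / real (m + k)"
| "coefficient (Beyond m k) = real (m + k) / real k"
| "coefficient (Before m k) = - real m / real k"
| "coefficient Apart = 0"
| "coefficient Same = 0"

lemma fits_real:
  assumes "proper \<rho>" "fits \<rho> p q t"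
  shows "real t - real p = coefficient \<rho> * (real q - real p)"
proof (cases \<rho>)
  case (Between m k)
  with assms have "real t * (real m + real k) = real p * real k + real q * real m" "real m + real k \<noteq> 0"
    by (simp_all flip: of_nat_add of_nat_mult)
  then show ?thesis by (simp add: Between field_simps)
next
  case (Beyond m k)
  with assms have "real t * real k + real p * real m = real q * (real m + real k)" "real k \<noteq> 0"
    by (simp_all flip: of_nat_add of_nat_mult)
  then show ?thesis by (simp add: Beyond field_simps)
next
  case (Before m k)
  with assms have "real t * real k + real q * real m = real p * (real m + real k)" "real k \<noteq> 0"
    by (simp_all flip: of_nat_add of_nat_mult)
  then show ?thesis by (simp add: Before field_simps)
qed (use assms in auto)

text \<open>The parameter of a proper ratio is neither 0 nor 1, so the third point meets an end only
  if the ends coincide. This yields the distinctness that \<open>no_three_collinear\<close> asks for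
  and \<open>line_free\<close> leaves implicit.\<close>

lemma fits_distinct:
  assumes "proper \<rho>" "fits \<rho> p q t" "t = p \<or> t = q"
  shows "p = q"
proof -
  have "coefficient \<rho> \<noteq> 0" "coefficient \<rho> \<noteq> 1"
    using assms(1) by (cases \<rho>; simp add: field_simps)+
  moreover have "coefficient \<rho> * (real q - real p) = 0 \<or> (1 - coefficient \<rho>) * (real q - real p) = 0"
    using fits_real[OF assms(1,2)] assms(3) by (auto simp: left_diff_distrib)
  ultimately show ?thesis by auto
qed

text \<open>Moves the first point to the origin, where \<open>collinear_lemma\<close> turns
  collinearity into a scalar multiple.\<close>

lemma collinear_iff_differences:
  fixes a b c :: "real ^ 'n"
  shows "collinear {a, b, c} \<longleftrightarrow> collinear {0, b - a, c - a}"
proof -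
  have "{a, b, c} = {b, a, c}" by auto
  then show ?thesis using collinear_3[of b a c] by (simp add: NO_MATCH_def)
qed

lemma card_eq_layer_total:
  "card {(x, y). x \<le> m \<and> y \<le> m \<and> g x y} = layer_total m g"
proof -
  have "layer_total m g = (\<Sum>(x, y)\<in>{0..m} \<times> {0..m}. of_bool (g x y))"
    by (simp only: layer_total_def sum.cartesian_product)
  also have "\<dots> = (\<Sum>p\<in>{0..m} \<times> {0..m}. of_bool (g (fst p) (snd p)))"
    by (simp only: case_prod_unfold)
  also have "\<dots> = card ({0..m} \<times> {0..m} \<inter> {p. g (fst p) (snd p)})"
    by simp
  also have "{0..m} \<times> {0..m} \<inter> {p. g (fst p) (snd p)} = {(x, y). x \<le> m \<and> y \<le> m \<and> g x y}"
    by auto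
  finally show ?thesis ..
qed

lemma other_axes: "\<exists>j k. i \<noteq> j \<and> i \<noteq> k \<and> j \<noteq> k \<and> (\<forall>l. l = i \<or> l = j \<or> l = k)" for i :: 3
proof -
  consider "i = 1" | "i = 2" | "i = 3" using exhaust_3 by blast
  then show ?thesis
  proof cases
    case 1
    have "(1::3) \<noteq> 2 \<and> (1::3) \<noteq> 3 \<and> (2::3) \<noteq> 3 \<and> (\<forall>l::3. l = 1 \<or> l = 2 \<or> l = 3)"
      using exhaust_3 by simp
    with 1 show ?thesis by blast
  next
    case 2
    have "(2::3) \<noteq> 1 \<and> (2::3) \<noteq> 3 \<and> (1::3) \<noteq> 3 \<and> (\<forall>l::3. l = 2 \<or> l = 1 \<or> l = 3)"
      using exhaust_3 by auto
    with 2 show ?thesis by blast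
  next
    case 3
    have "(3::3) \<noteq> 1 \<and> (3::3) \<noteq> 2 \<and> (1::3) \<noteq> 2 \<and> (\<forall>l::3. l = 3 \<or> l = 1 \<or> l = 2)"
      using exhaust_3 by auto
    with 3 show ?thesis by blast
  qed
qed

lemma nth_P:
  assumes "k < n" "2 \<le> n"
  shows "P n ! k = (if k = 0 \<or> k = n - 1 then 2 * n else 2 * n - 2)"
  using assms by (auto simp: P_def nth_Cons nth_append split: nat.splits)

lemma config_of_profile:
  assumes S: "S \<subseteq> grid (Suc m)" "no_three_collinear S" "layer_profile (Suc m) S i = P (Suc m)"
    and "0 < m"
  shows "\<exists>s. config m s"
proof -
  obtain j k where ijk: "i \<noteq> j" "i \<noteq> k" "j \<noteq> k" "\<And>l. l = i \<or> l = j \<or> l = k"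
    using other_axes by metis
  \<comment> \<open>Height goes to axis \<open>i\<close>, row to \<open>j\<close> and column to the
    remaining axis \<open>k\<close>; the order of the last two is immaterial.\<close>
  define e :: "nat \<Rightarrow> nat \<Rightarrow> nat \<Rightarrow> real ^ 3" where
    "e = (\<lambda>z x y. \<chi> l. real (if l = i then z else if l = j then x else y))"
  define s where "s = (\<lambda>z x y. z \<le> m \<and> x \<le> m \<and> y \<le> m \<and> e z x y \<in> S)"
  have e: "e z x y $ i = real z" "e z x y $ j = real x" "e z x y $ k = real y" for z x y
    by (simp_all only: e_def vec_lambda_beta ijk(1-3)[THEN not_sym] if_False if_True simp_thms)
  have e_inj: "e z x y = e z' x' y' \<longleftrightarrow> z = z' \<and> x = x' \<and> y = y'" for z x y z' x' y'
  proof
    assume "e z x y = e z' x' y'"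
    then have "e z x y $ i = e z' x' y' $ i" "e z x y $ j = e z' x' y' $ j"
      "e z x y $ k = e z' x' y' $ k" by simp_all
    then show "z = z' \<and> x = x' \<and> y = y'" by (simp only: e of_nat_eq_iff)
  qed simp
  have "line_free s"
    unfolding line_free_def
  proof (intro allI impI, rule ccontr)
    fix \<rho> x y z x' y' z' u v w
    assume \<rho>: "proper \<rho>" and s: "s z x y" "s z' x' y'" "s w u v"
      and f: "fits \<rho> z z' w" "fits \<rho> x x' u" "fits \<rho> y y' v"
      and ne: "\<not> (z = z' \<and> x = x' \<and> y = y')"
    have "e w u v - e z x y = coefficient \<rho> *\<^sub>R (e z' x' y' - e z x y)"
      unfolding vec_eq_iff
    proof
      fix l
      show "(e w u v - e z x y) $ l = (coefficient \<rho> *\<^sub>R (e z' x' y' - e z x y)) $ l"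
        using ijk(4)[of l] fits_real[OF \<rho> f(1)] fits_real[OF \<rho> f(2)] fits_real[OF \<rho> f(3)]
        by (elim disjE) (simp_all only: e vector_minus_component vector_scaleR_component real_scaleR_def)
    qed
    then have "collinear {0, e z' x' y' - e z x y, e w u v - e z x y}"
      unfolding collinear_lemma by blast
    then have "collinear {e z x y, e z' x' y', e w u v}"
      by (rule iffD2[OF collinear_iff_differences])
    moreover have "e z x y \<noteq> e z' x' y'" "e z' x' y' \<noteq> e w u v" "e z x y \<noteq> e w u v"
      using ne fits_distinct[OF \<rho> f(1)] fits_distinct[OF \<rho> f(2)] fits_distinct[OF \<rho> f(3)]
      by (auto simp: e_inj)
    ultimately show False
      using S(2) s unfolding no_three_collinear_def s_def by blast
  qed
  moreover have "layer_total m (s z) = (if z = 0 \<or> z = m then 2 * Suc m else 2 * m)" if "z \<le> m" for z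
  proof -
    have "{v \<in> S. v $ i = real z} = (\<lambda>(x, y). e z x y) ` {(x, y). x \<le> m \<and> y \<le> m \<and> s z x y}"
    proof (intro equalityI subsetI)
      fix v assume v: "v \<in> {v \<in> S. v $ i = real z}"
      then have "v \<in> grid (Suc m)" using S(1) by blast
      then have "v $ j \<in> real ` {0..<Suc m}" "v $ k \<in> real ` {0..<Suc m}"
        unfolding grid_def by blast+
      then obtain x y where xy: "v $ j = real x" "x \<le> m" "v $ k = real y" "y \<le> m"
        by (auto simp: less_Suc_eq_le)
      have "v = e z x y"
        unfolding vec_eq_iff
      proof
        fix l show "v $ l = e z x y $ l" using ijk(4)[of l] v xy e by auto
      qed
      with v xy that show "v \<in> (\<lambda>(x, y). e z x y) ` {(x, y). x \<le> m \<and> y \<le> m \<and> s z x y}"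
        by (auto simp: s_def)
    qed (auto simp: s_def e)
    moreover have "inj_on (\<lambda>(x, y). e z x y) A" for A
      by (auto simp: inj_on_def e_inj)
    ultimately have "layer_total m (s z) = card {v \<in> S. v $ i = real z}"
      by (simp only: card_image card_eq_layer_total)
    also have "\<dots> = layer_profile (Suc m) S i ! z"
      using that by (simp add: layer_profile_def del: upt_Suc)
    also have "\<dots> = (if z = 0 \<or> z = m then 2 * Suc m else 2 * m)"
      using S(3) that \<open>0 < m\<close> by (simp add: nth_P)
    finally show ?thesis .
  qed
  ultimately have "config m s" by (auto simp: config_def s_def)
  then show ?thesis by blast
qed

section \<open>A computable certificate of noncollinearity\<close>

fun bend :: "comparison \<Rightarrow> bool \<Rightarrow> bool" where
  "bend (Less d) b = True"
| "bend (Greater d) b = True"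
| "bend Equal b = b"

text \<open>Compares the two halves of each 2 by 2 minor of the difference vectors. Expanded, the
  common product cancels, and the negative terms are moved across so that only natural numbers
  occur. One nonzero minor rules out collinearity.\<close>

fun bent :: "point \<Rightarrow> point \<Rightarrow> point \<Rightarrow> bool" where
  "bent (Point a b c) (Point a' b' c') (Point a'' b'' c'') =
     bend (cmp (a' * b'' + b' * a + b * a'') (a' * b + a * b'' + b' * a''))
      (bend (cmp (b' * c'' + c' * b + c * b'') (b' * c + b * c'' + c' * b''))
        (bend (cmp (a' * c'' + c' * a + c * a'') (a' * c + a * c'' + c' * a'')) False))"

fun bent_pair :: "point \<Rightarrow> point \<Rightarrow> point list \<Rightarrow> bool" where
  "bent_pair p q [] = True"
| "bent_pair p q (r # rs) = (bent p q r \<and> bent_pair p q rs)"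

fun bent_from :: "point \<Rightarrow> point list \<Rightarrow> bool" where
  "bent_from p [] = True"
| "bent_from p (q # qs) = (bent_pair p q qs \<and> bent_from p qs)"

fun all_bent :: "point list \<Rightarrow> bool" where
  "all_bent [] = True"
| "all_bent (p # ps) = (bent_from p ps \<and> all_bent ps)"

fun coordinate :: "3 \<Rightarrow> point \<Rightarrow> nat" where
  "coordinate i (Point x y z) = (if i = 1 then x else if i = 2 then y else z)"

definition to_vec :: "point \<Rightarrow> real ^ 3" where
  "to_vec p = (\<chi> i. real (coordinate i p))"

lemma to_vec_inj: "to_vec p = to_vec q \<longleftrightarrow> p = q"
  by (cases p; cases q) (auto simp: to_vec_def vec_eq_iff forall_3)

lemma bent_imp_not_collinear:
  assumes "bent p q r"
  shows "\<not> collinear {to_vec p, to_vec q, to_vec r}"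
proof
  assume "collinear {to_vec p, to_vec q, to_vec r}"
  then have "collinear {0, to_vec q - to_vec p, to_vec r - to_vec p}"
    by (rule iffD1[OF collinear_iff_differences])
  then consider "to_vec q - to_vec p = 0" | "to_vec r - to_vec p = 0"
    | c where "to_vec r - to_vec p = c *\<^sub>R (to_vec q - to_vec p)"
    unfolding collinear_lemma by blast
  \<comment> \<open>In all three cases the difference vectors are linearly dependent, so every minor
    vanishes.\<close>
  then have det: "(to_vec q $ i - to_vec p $ i) * (to_vec r $ j - to_vec p $ j) =
      (to_vec q $ j - to_vec p $ j) * (to_vec r $ i - to_vec p $ i)" for i j
  proof cases
    case 3
    then have "to_vec r $ l - to_vec p $ l = c * (to_vec q $ l - to_vec p $ l)" for l
      by (metis vector_minus_component vector_scaleR_component real_scaleR_def)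
    then show ?thesis by simp
  qed (simp_all add: vec_eq_iff)
  obtain a b c where p: "p = Point a b c" by (cases p)
  obtain a' b' c' where q: "q = Point a' b' c'" by (cases q)
  obtain a'' b'' c'' where r: "r = Point a'' b'' c''" by (cases r)
  have nat: "x' * y'' + y' * x + y * x'' = x' * y + x * y'' + y' * x''"
    if "(real x' - real x) * (real y'' - real y) = (real y' - real y) * (real x'' - real x)"
    for x y x' y' x'' y'' :: nat
  proof -
    have "real (x' * y'' + y' * x + y * x'') = real (x' * y + x * y'' + y' * x'')"
      using that by (simp add: algebra_simps)
    then show ?thesis by (simp only: of_nat_eq_iff)
  qed
  have "cmp i i = Equal" for i by (induction i) auto
  then show False
    using assms nat[OF det[of 1 2, unfolded p q r to_vec_def, simplified]]
      nat[OF det[of 2 3, unfolded p q r to_vec_def, simplified]]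
      nat[OF det[of 1 3, unfolded p q r to_vec_def, simplified]]
    by (simp add: p q r)
qed

lemma bent_pair_nth: "bent_pair p q rs \<Longrightarrow> r \<in> set rs \<Longrightarrow> bent p q r"
  by (induction rs) auto

text \<open>\<open>all_bent\<close> tests each triple in list order only; the other orders follow
  because collinearity concerns the unordered set.\<close>

lemma all_bent_imp_not_collinear:
  assumes "all_bent L" "p \<in> set L" "q \<in> set L" "r \<in> set L" "p \<noteq> q" "q \<noteq> r" "p \<noteq> r"
  shows "\<not> collinear {to_vec p, to_vec q, to_vec r}"
proof -
  have from_p: "\<not> collinear {to_vec p, to_vec q, to_vec r}"
    if "bent_from p ps" "q \<in> set ps" "r \<in> set ps" "q \<noteq> r" for p q r ps
    using that
  proof (induction ps)
    case (Cons a ps)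
    then consider "q = a" "r \<in> set ps" | "r = a" "q \<in> set ps" | "q \<in> set ps" "r \<in> set ps" by auto
    then show ?case
    proof cases
      case 1
      then show ?thesis using Cons.prems(1) bent_pair_nth bent_imp_not_collinear by auto
    next
      case 2
      then have "\<not> collinear {to_vec p, to_vec r, to_vec q}"
        using Cons.prems(1) bent_pair_nth bent_imp_not_collinear by auto
      then show ?thesis by (simp add: insert_commute)
    qed (use Cons in auto)
  qed simp
  show ?thesis
    using assms
  proof (induction L)
    case (Cons a L)
    consider "p = a" | "q = a" | "r = a" | "p \<in> set L" "q \<in> set L" "r \<in> set L"
      using Cons.prems by auto
    then show ?case
    proof cases
      case 1
      with Cons.prems from_p[of p L q r] show ?thesis by auto
    next
      case 2
      with Cons.prems from_p[of q L p r] show ?thesis by (auto simp: insert_commute)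
    next
      case 3
      with Cons.prems from_p[of r L p q] show ?thesis by (auto simp: insert_commute)
    qed (use Cons in auto)
  qed simp
qed

lemma config_of_list:
  assumes "all_bent L" "distinct L"
    and "\<And>i k. k < n \<Longrightarrow> length (filter (\<lambda>p. coordinate i p = k) L) = P n ! k"
    and "\<And>i p. p \<in> set L \<Longrightarrow> coordinate i p < n" and "2 \<le> n"
  shows "\<exists>S. S \<subseteq> grid n \<and> no_three_collinear S \<and> (\<forall>i. layer_profile n S i = P n)"
proof (intro exI conjI allI)
  show "to_vec ` set L \<subseteq> grid n"
    using assms(4) by (auto simp: grid_def to_vec_def)
  show "no_three_collinear (to_vec ` set L)"
    unfolding no_three_collinear_def using all_bent_imp_not_collinear[OF assms(1)]
    by (auto simp: to_vec_inj)
  show "layer_profile n (to_vec ` set L) i = P n" for i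
  proof (rule nth_equalityI)
    show "length (layer_profile n (to_vec ` set L) i) = length (P n)"
      using assms(5) by (simp add: layer_profile_def P_def)
    fix k assume "k < length (layer_profile n (to_vec ` set L) i)"
    then have k: "k < n" by (simp add: layer_profile_def)
    have "{x \<in> to_vec ` set L. x $ i = real k} = to_vec ` ({p. coordinate i p = k} \<inter> set L)"
      by (auto simp: to_vec_def)
    moreover have "inj_on to_vec A" for A by (simp add: inj_on_def to_vec_inj)
    ultimately have "card {x \<in> to_vec ` set L. x $ i = real k} = length (filter (\<lambda>p. coordinate i p = k) L)"
      using assms(2) by (simp only: card_image distinct_length_filter)
    with assms(3)[OF k] k show "layer_profile n (to_vec ` set L) i ! k = P n ! k"
      by (simp add: layer_profile_def)
  qed
qed

section \<open>Evaluation\<close>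

fun points_at :: "nat \<Rightarrow> nat \<Rightarrow> nat list list \<Rightarrow> point list" where
  "points_at z x [] = []"
| "points_at z x (ys # l) = map (Point z x) ys @ points_at z (Suc x) l"

fun points_in :: "nat \<Rightarrow> nat list list list \<Rightarrow> point list" where
  "points_in z [] = []"
| "points_in z (l # ls) = points_at z 0 l @ points_in (Suc z) ls"

definition profile_example :: "nat \<Rightarrow> nat list list list \<Rightarrow> bool" where
  "profile_example n ls \<longleftrightarrow> all_bent (points_in 0 ls) \<and> distinct (points_in 0 ls) \<and>
     (\<forall>i. map (\<lambda>k. length (filter (\<lambda>p. coordinate i p = k) (points_in 0 ls))) [0..<n] = P n) \<and>
     (\<forall>i. \<forall>p\<in>set (points_in 0 ls). coordinate i p < n) \<and> 2 \<le> n"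

text \<open>Isolates the test of all triples as the first goal, to be evaluated in unary by a closed
  set of rules, while the counting goals go to the general simplifier.\<close>

lemma profile_exampleI:
  assumes "all_bent (points_in 0 ls)" "distinct (points_in 0 ls)"
    and "\<forall>i. map (\<lambda>k. length (filter (\<lambda>p. coordinate i p = k) (points_in 0 ls))) [0..<n] = P n"
    and "\<forall>i. \<forall>p\<in>set (points_in 0 ls). coordinate i p < n" "2 \<le> n"
  shows "profile_example n ls"
  using assms by (simp add: profile_example_def)

lemma profile_example:
  assumes "profile_example n ls"
  shows "\<exists>S. S \<subseteq> grid n \<and> no_three_collinear S \<and> (\<forall>i. layer_profile n S i = P n)"
proof (rule config_of_list)
  fix i k assume "k < n"
  then show "length (filter (\<lambda>p. coordinate i p = k) (points_in 0 ls)) = P n ! k"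
    using assms unfolding profile_example_def by (metis (no_types, lifting) add_0 diff_zero length_upt nth_map nth_upt)
qed (use assms in \<open>auto simp: profile_example_def\<close>)

lemma evaluation_basics:
  "(0::nat) + n = n" "Suc k + n = Suc (k + n)" "0 * n = (0::nat)" "Suc k * n = n + k * n"
  "[] @ ys = ys" "(x # xs) @ ys = x # (xs @ ys)"
  "([] :: cell list)[i := v] = []" "(c # cs)[0 := v] = (v :: cell) # cs"
  "(c # cs)[Suc i := v] = c # cs[i := v]" "rev [] = []" "rev (x # xs) = rev xs @ [x]"
  "map f [] = []" "map f (x # xs) = f x # map f xs" "(True \<and> b) = b" "(False \<and> b) = False"
  "(1::nat) = Suc 0" "(2::nat) = Suc (Suc 0)" "(3::nat) = Suc (Suc (Suc 0))"
  "(4::nat) = Suc (Suc (Suc (Suc 0)))" "(5::nat) = Suc (Suc (Suc (Suc (Suc 0))))"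
  "(6::nat) = Suc (Suc (Suc (Suc (Suc (Suc 0)))))"
  by auto

lemmas evaluation = evaluation_basics
  cmp.simps locate_below.simps locate_from_p.simps locate_from_q.simps locate.simps
  exact_div.simps exact_div_block.simps minus_opt.simps minus_quotient.simps third_between.simps
  third_beyond.simps third.simps put.simps put_opt.simps kill_cell.simps kill_cells.simps
  clear_opt.simps kill_row.simps kill_rows.simps kill_at.simps kill_layer.simps kill.simps
  kill_all.simps mark_rows.simps mark.simps row_info.simps row_infos.simps deficit.simps
  zip_cons.simps transpose_rows.simps select.simps better.simps choose_line.simps
  inspect_columns.simps inspect_rows.simps inspect_layer.simps inspect.simps first_open.simps
  line_point.simps verdict_of.simps solve.simps branch.simps points_of_row.simps points_of.simps
  choose_lines.simps row_positions.simps positions.simps cross_point.simps cross_row.simps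
  cross_rows.simps cross_layer.simps cross.simps is_Nil.simps pairs_excluded.simps eq_row.simps
  eq_rows.simps eq_rows_rest.simps mem_rows.simps mem_rows_rest.simps remove_orbit.simps
  remove_head.simps flips.simps orbit.simps full_layers_excluded.simps copies.simps open_layer.simps
  rows_of.simps full_layers_def impossible_def bend.simps bent.simps bent_pair.simps
  bent_from.simps all_bent.simps points_at.simps points_in.simps

section \<open>Explicit sets for n = 2, 3, 4, 6\<close>

lemma profile_example_2: "profile_example 2 [
     [[0, 1], [0, 1]],
     [[0, 1], [0, 1]]]"
  by (rule profile_exampleI, simp only: evaluation)
    (simp_all add: forall_3 P_def upt_rec numeral_eq_Suc)

text \<open>The twelve edge midpoints of the cube together with four of its vertices that form a
  regular tetrahedron.\<close>

lemma profile_example_3: "profile_example 3 [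
     [[1, 2], [0, 2], [0, 1]],
     [[0, 2], [], [0, 2]],
     [[0, 1], [0, 2], [1, 2]]]"
  by (rule profile_exampleI, simp only: evaluation)
    (simp_all add: forall_3 P_def upt_rec numeral_eq_Suc)

text \<open>The set is invariant under reflection of the rows and under the half-turn that reverses
  heights and columns.\<close>

lemma profile_example_4: "profile_example 4 [
     [[1, 3], [0, 2], [0, 2], [1, 3]],
     [[0, 1], [3], [3], [0, 1]],
     [[2, 3], [0], [0], [2, 3]],
     [[0, 2], [1, 3], [1, 3], [0, 2]]]"
  by (rule profile_exampleI, simp only: evaluation)
    (simp_all add: forall_3 P_def upt_rec numeral_eq_Suc)

text \<open>The set is invariant under cyclic permutation of the axes and the half-turns about the
  three central axes, that is, under the rotation group of a regular tetrahedron. Hence one profile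
  settles all three.\<close>

lemma profile_example_6: "profile_example 6 [
     [[3, 5], [1, 3], [4, 5], [0, 1], [2, 4], [0, 2]],
     [[1, 3], [0], [2, 5], [0, 3], [5], [2, 4]],
     [[4, 5], [2, 5], [1], [4], [0, 3], [0, 1]],
     [[0, 1], [0, 3], [4], [1], [2, 5], [4, 5]],
     [[2, 4], [5], [0, 3], [2, 5], [0], [1, 3]],
     [[0, 2], [2, 4], [0, 1], [4, 5], [1, 3], [3, 5]]]"
  by (rule profile_exampleI, simp only: evaluation)
    (simp_all add: forall_3 P_def upt_rec numeral_eq_Suc)


section \<open>Nonexistence for n = 5 and n = 7\<close>

lemma impossible_5: "impossible 4 [1, 2, 3]"
  by (simp only: evaluation)

text \<open>Ruling out the outer layers with three inner ones is stronger than with all five, and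
  the states stay smaller.\<close>

lemma impossible_7: "impossible 6 [2, 3, 4]"
  by (simp only: evaluation)

theorem mainTheorem4:
  shows "(\<forall>n::nat. n \<ge> 2 \<longrightarrow>
            length (P n) = n \<and> int (sum_list (P n)) = 2 * int n ^ 2 - 2 * int n + 4)
       \<and> (\<forall>n\<in>{2, 3, 4, 6::nat}. \<exists>S. S \<subseteq> grid n \<and> no_three_collinear S \<and>
            (\<forall>i. layer_profile n S i = P n))
       \<and> (\<forall>n\<in>{5, 7::nat}. \<not> (\<exists>S. S \<subseteq> grid n \<and> no_three_collinear S \<and>
            (\<exists>i. layer_profile n S i = P n)))"
proof (intro conjI allI impI)
  fix n :: nat assume "n \<ge> 2"
  then obtain k where n: "n = k + 2" using le_Suc_ex by (metis add.commute)
  show "length (P n) = n" by (simp add: P_def n)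
  show "int (sum_list (P n)) = 2 * int n ^ 2 - 2 * int n + 4"
    by (simp add: P_def n sum_list_replicate power2_eq_square algebra_simps)
next
  show "\<forall>n\<in>{2, 3, 4, 6::nat}. \<exists>S. S \<subseteq> grid n \<and> no_three_collinear S \<and>
      (\<forall>i. layer_profile n S i = P n)"
    using profile_example_2 profile_example_3 profile_example_4 profile_example_6 profile_example by blast
next
  have "\<not> config 4 s" for s
    by (rule not_config_if_impossible[OF impossible_5]) force
  moreover have "\<not> config 6 s" for s
    by (rule not_config_if_impossible[OF impossible_7]) force
  ultimately show "\<forall>n\<in>{5, 7::nat}. \<not> (\<exists>S. S \<subseteq> grid n \<and> no_three_collinear S \<and>
      (\<exists>i. layer_profile n S i = P n))"
    using config_of_profile[where m = 4] config_of_profile[where m = 6] by auto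
qed

end
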